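(* Let $n\ge1$. For Lebesgue-almost every $\boldsymbol\alpha\in\mathbb R^n$ and all $\boldsymbol T=(T_1,\dots,T_n)\in[1,+\infty)^n$, $$S(\boldsymbol\alpha,\boldsymbol T)\asymp_{\boldsymbol\alpha,n}\log\bar T\,\log T_1\cdots\log T_n,\qquad \bar T:=(T_1\cdots T_n)^{1/n}.$$ Moreover, for Lebesgue-almost every $\boldsymbol\alpha\in\mathbb R^n$ and all $T\ge1$, $$S^*(\boldsymbol\alpha,T)\asymp_{\boldsymbol\alpha,n}(\log T)^{n+1}.$$
   Context: For $x\in\mathbb R$, $\|x\|$ is the distance from $x$ to the nearest integer, $x^+:=\max\{1,x\}$, and throughout $\log x$ stands for $\log\max\{x,e\}$. For $\boldsymbol\alpha\in\mathbb R^n$, $\boldsymbol T\in[1,\infty)^n$, $T\ge1$: $$S(\boldsymbol\alpha,\boldsymbol T):=\sum_{\substack{\boldsymbol q\in\mathbb Z^n\setminus\{\boldsymbol 0\}\\ 0\le q_i\le T_i}}\frac{1}{q_1^+\cdots q_n^+\,\|\boldsymbol q\cdot\boldsymbol\alpha\|},\qquad S^*(\boldsymbol\alpha,T):=\sum_{q\in\mathbb Z,\ 0<q\le T}\frac{1}{q\,\|q\alpha_1\|\cdots\|q\alpha_n\|},$$ where $\boldsymbol q\cdot\boldsymbol\alpha$ is the dot product. $X\asymp_z Y$ means $X\ll_z Y$ and $Y\ll_z X$, with implied constants depending only on $z$. *)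

theory Defs
  imports "HOL-Analysis.Analysis"
begin

definition dnint :: "real \<Rightarrow> real" where
  "dnint x = \<bar>x - real_of_int (round x)\<bar>"

text \<open>The paper's convention: log x stands for log max{x, e}.\<close>
definition logp :: "real \<Rightarrow> real" where
  "logp x = ln (max x (exp 1))"

definition posp :: "real \<Rightarrow> real" where
  "posp x = max 1 x"

definition S_sum :: "real ^ 'n \<Rightarrow> real ^ 'n \<Rightarrow> real" where
  "S_sum \<alpha> T = (\<Sum>q \<in> {q :: int ^ 'n. q \<noteq> 0 \<and> (\<forall>i. 0 \<le> q $ i \<and> real_of_int (q $ i) \<le> T $ i)}.
      1 / ((\<Prod>i\<in>UNIV. posp (real_of_int (q $ i))) * dnint (\<Sum>i\<in>UNIV. real_of_int (q $ i) * \<alpha> $ i)))"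

definition S_star :: "real ^ 'n \<Rightarrow> real \<Rightarrow> real" where
  "S_star \<alpha> T = (\<Sum>q \<in> {q :: nat. 0 < q \<and> real q \<le> T}.
      1 / (real q * (\<Prod>i\<in>UNIV. dnint (real q * \<alpha> $ i))))"

end

theory Submission
  imports Defs "HOL-Probability.Probability" "HOL-Library.Discrete_Functions"
begin

text \<open>Replace each reciprocal by a sum over dyadic levels and compare the sums with their means on
  the torus. Along boxes of doubly exponential size, a second moment argument controls all levels
  except a logarithmically thin range around the critical one: phases of non-parallel integer vectors
  are pairwise independent, and for parallel vectors a counting argument bounds the covariance. The
  thin range contributes negligibly in mean, and the levels above it are almost surely empty by
  Borel-Cantelli. Monotonicity in T extends the estimates from the boxes to all T.\<close>

subsection \<open>Distance to the nearest integer\<close>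

text \<open>The obstacle is that 1 / \<open>dnint\<close> of a uniform phase is not integrable: the
  full sum has infinite mean, and no moment method applies to it. A single dyadic level is harmless.
  For a multi-index j it has height 2^|j| and probability 2^-|j|, so its mean is
  \<open>weight q\<close> whatever j is. The size of the sum is thus governed by the number of
  levels that really occur for q, about (log of 1 / \<open>weight q\<close>)^r for r phases. On a
  box this gives L^r * P with L = \<open>bigL k\<close> and P = \<open>bigP k\<close>.

  The critical depth of q is where 2^|j| * \<open>weight q\<close> has order 1. Well before it, many
  q share a level and averages concentrate; well beyond it, a typical box has no q at all on the
  level. The transition range has thickness proportional to |k| = \<open>sum k UNIV\<close>, the
  binary logarithm of P: this buys any fixed power of P on either side, but costs only a proportion
  |k| / L of the levels.

  The estimates must hold for all multi-indices k, also for very elongated boxes, where L is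
  comparable to P. All exceptional probabilities are bounded by a constant times (1 + |k|) / L,
  which is still summable over k.\<close>

lemma dnint_le_iff: "dnint x \<le> s \<longleftrightarrow> (\<exists>m::int. \<bar>x - of_int m\<bar> \<le> s)"
proof
  assume "dnint x \<le> s"
  then show "\<exists>m::int. \<bar>x - of_int m\<bar> \<le> s" unfolding dnint_def by blast
next
  assume "\<exists>m::int. \<bar>x - of_int m\<bar> \<le> s"
  then obtain m :: int where "\<bar>x - of_int m\<bar> \<le> s" by blast
  then show "dnint x \<le> s"
    unfolding dnint_def using round_diff_minimal[of x m] by linarith
qed

lemma dnint_nonneg [simp]: "0 \<le> dnint x"
  by (simp add: dnint_def)

lemma dnint_le_half: "dnint x \<le> 1 / 2"
  unfolding dnint_def using of_int_round_abs_le[of x] by (simp add: abs_minus_commute)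

lemma dnint_add_of_int [simp]: "dnint (x + of_int m) = dnint x"
proof -
  have *: "dnint (y + of_int k) \<le> dnint y" for y and k :: int
    unfolding dnint_le_iff
    by (rule exI[of _ "round y + k"]) (simp add: dnint_def)
  from *[of x m] *[of "x + of_int m" "- m"] show ?thesis by simp
qed

lemma dnint_add_Ints: "z \<in> \<int> \<Longrightarrow> dnint (x + z) = dnint x"
  by (erule Ints_cases) simp

text \<open>Far from the integers means near the half-integers. This lets an upper bound for the
  measure of such neighbourhoods also yield the matching lower bound.\<close>

lemma dnint_add_half_le: "s < dnint x \<Longrightarrow> dnint (x + 1 / 2) \<le> 1 / 2 - s"
proof -
  assume s: "s < dnint x"
  define r where "r = x - of_int (round x)"
  have r: "\<bar>r\<bar> \<le> 1 / 2" "s < \<bar>r\<bar>"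
    using dnint_le_half[of x] s by (auto simp: dnint_def r_def)
  show ?thesis
  proof (cases "r \<ge> 0")
    case True
    then show ?thesis unfolding dnint_le_iff
      by (intro exI[of _ "round x + 1"]) (use r in \<open>auto simp: r_def\<close>)
  next
    case False
    then show ?thesis unfolding dnint_le_iff
      by (intro exI[of _ "round x"]) (use r in \<open>auto simp: r_def\<close>)
  qed
qed

lemma measurable_dnint [measurable]: "dnint \<in> borel_measurable borel"
  unfolding dnint_def[abs_def] round_def by measurable

lemma card_int_interval_le:
  fixes y \<rho> :: real
  assumes "0 \<le> \<rho>"
  shows "finite {c::int. \<bar>y + of_int c\<bar> \<le> \<rho>}" "real (card {c::int. \<bar>y + of_int c\<bar> \<le> \<rho>}) \<le> 2 * \<rho> + 1"
proof -
  have eq: "{c::int. \<bar>y + of_int c\<bar> \<le> \<rho>} = {\<lceil>- y - \<rho>\<rceil>..\<lfloor>- y + \<rho>\<rfloor>}"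
    by (auto simp: ceiling_le_iff le_floor_iff abs_le_iff)
  show "finite {c::int. \<bar>y + of_int c\<bar> \<le> \<rho>}" by (simp add: eq)
  have "real_of_int \<lfloor>- y + \<rho>\<rfloor> \<le> - y + \<rho>" "- y - \<rho> \<le> real_of_int \<lceil>- y - \<rho>\<rceil>" by auto
  then show "real (card {c::int. \<bar>y + of_int c\<bar> \<le> \<rho>}) \<le> 2 * \<rho> + 1"
    using assms by (simp add: eq) linarith
qed

text \<open>Coprimality makes the fractions b * i / a run exactly once through the multiples of 1 /
  a modulo 1. After multiplication by a, the hits become distinct integers in an interval of length
  2 * s * a.\<close>

lemma card_dnint_progression_le:
  fixes z s :: real and a b :: nat
  assumes a: "0 < a" and ab: "coprime a b" and s: "0 \<le> s"
  shows "real (card {i. i < a \<and> dnint (z + real b * real i / real a) \<le> s}) \<le> 2 * s * real a + 1"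
proof -
  let ?I = "{i. i < a \<and> dnint (z + real b * real i / real a) \<le> s}"
  let ?C = "{c::int. \<bar>z * real a + of_int c\<bar> \<le> s * real a}"
  \<comment> \<open>Congruent to b * i modulo a, hence it determines i < a. Adding z * a gives a
    times the signed distance of the i-th point from its nearest integer.\<close>
  define f where "f i = int b * int i - int a * round (z + real b * real i / real a)" for i
  have inj: "inj_on f ?I"
  proof (rule inj_onI)
    fix i i' assume i: "i \<in> ?I" "i' \<in> ?I" and eq: "f i = f i'"
    have "int b * (int i - int i') = int a * (round (z + real b * real i / real a) - round (z + real b * real i' / real a))"
      using eq unfolding f_def by (simp add: algebra_simps)
    then have "int a dvd int b * (int i - int i')" by simp
    moreover have "coprime (int a) (int b)" using ab by simp
    ultimately have "int a dvd int i - int i'" using coprime_dvd_mult_right_iff by blast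
    moreover have "\<bar>int i - int i'\<bar> < int a" using i by auto
    ultimately have "int i - int i' = 0" by (metis abs_of_nat dvd_imp_le_int linorder_not_less)
    then show "i = i'" by simp
  qed
  have sub: "f ` ?I \<subseteq> ?C"
  proof clarify
    fix i assume i: "i < a" "dnint (z + real b * real i / real a) \<le> s"
    have "z * real a + of_int (f i)
        = real a * (z + real b * real i / real a - of_int (round (z + real b * real i / real a)))"
      using a unfolding f_def by (simp add: field_simps)
    then have "\<bar>z * real a + of_int (f i)\<bar> = real a * dnint (z + real b * real i / real a)"
      unfolding dnint_def by (simp add: abs_mult)
    also have "\<dots> \<le> s * real a" using i by (simp add: mult.commute mult_left_mono)
    finally show "\<bar>z * real a + of_int (f i)\<bar> \<le> s * real a" .
  qed
  have fin: "finite ?C" using card_int_interval_le(1)[of "s * real a" "z * real a"] s by simp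
  have "card ?I = card (f ` ?I)" using inj by (simp add: card_image)
  also have "\<dots> \<le> card ?C" by (rule card_mono[OF fin sub])
  finally have "real (card ?I) \<le> real (card ?C)" by simp
  also have "\<dots> \<le> 2 * (s * real a) + 1" using card_int_interval_le(2)[of "s * real a" "z * real a"] s by simp
  finally show ?thesis by simp
qed

subsection \<open>Translation invariance on the torus\<close>

definition unit_cube :: "(real ^ 'n) set" where
  "unit_cube = {\<alpha>. \<forall>i. 0 \<le> \<alpha> $ i \<and> \<alpha> $ i < 1}"

text \<open>Haar measure of the quotient by the integer lattice, carried by a half-open fundamental
  cube. Events stay subsets of the full space, so invariance under the lattice has to be asked for
  separately through \<open>periodic\<close>.\<close>

definition torus :: "(real ^ 'n) measure" where
  "torus = uniform_measure lborel unit_cube"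

definition lattice_vec :: "int ^ 'n \<Rightarrow> real ^ 'n" where
  "lattice_vec m = (\<chi> i. of_int (m $ i))"

definition periodic :: "(real ^ 'n) set \<Rightarrow> bool" where
  "periodic A \<longleftrightarrow> (\<forall>\<alpha> m. \<alpha> + lattice_vec m \<in> A \<longleftrightarrow> \<alpha> \<in> A)"

lemma sets_unit_cube [measurable]: "unit_cube \<in> sets borel"
  unfolding unit_cube_def by measurable

lemma emeasure_unit_cube [simp]: "emeasure lborel (unit_cube :: (real ^ 'n) set) = 1"
proof (rule antisym)
  have one: "\<And>b::real ^ 'n. b \<in> Basis \<Longrightarrow> (1::real^'n) \<bullet> b = 1"
    by (auto simp: Basis_vec_def inner_axis)
  have "emeasure lborel (unit_cube :: (real ^ 'n) set) \<le> emeasure lborel (cbox 0 (1::real^'n))"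
    by (intro emeasure_mono) (auto simp: unit_cube_def mem_box_cart less_imp_le)
  also have "\<dots> = 1" by (simp add: emeasure_lborel_cbox_eq one)
  finally show "emeasure lborel (unit_cube :: (real ^ 'n) set) \<le> 1" .
  have "1 = emeasure lborel (box 0 (1::real^'n))" by (simp add: emeasure_lborel_box_eq one)
  also have "\<dots> \<le> emeasure lborel (unit_cube :: (real ^ 'n) set)"
    by (intro emeasure_mono) (auto simp: unit_cube_def mem_box_cart less_imp_le)
  finally show "1 \<le> emeasure lborel (unit_cube :: (real ^ 'n) set)" .
qed

lemma prob_space_torus: "prob_space torus"
  unfolding torus_def by (rule prob_space_uniform_measure) auto

lemma sets_torus [simp, measurable_cong]: "sets torus = sets borel"
  by (simp add: torus_def)

lemma space_torus [simp]: "space torus = UNIV"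
  by (simp add: torus_def)

lemma emeasure_torus: "A \<in> sets borel \<Longrightarrow> emeasure torus A = emeasure lborel (unit_cube \<inter> A)"
  unfolding torus_def by (simp add: emeasure_uniform_measure divide_ennreal_def)

lemma emeasure_lborel_translate:
  fixes u :: "'a::euclidean_space"
  assumes "B \<in> sets borel"
  shows "emeasure lborel {\<alpha>. \<alpha> + u \<in> B} = emeasure lborel B"
proof -
  have "emeasure lborel B = emeasure (distr lborel borel ((+) u)) B" by (simp add: lborel_distr_plus)
  also have "\<dots> = emeasure lborel ((+) u -` B \<inter> space lborel)"
    by (rule emeasure_distr) (use assms in auto)
  also have "(+) u -` B \<inter> space lborel = {\<alpha>. \<alpha> + u \<in> B}" by (auto simp: add.commute)
  finally show ?thesis by simp
qed

lemma unit_cube_tiling: "\<exists>!m. \<beta> - lattice_vec m \<in> unit_cube"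
proof
  show "\<beta> - lattice_vec (\<chi> i. \<lfloor>\<beta> $ i\<rfloor>) \<in> unit_cube"
    unfolding unit_cube_def lattice_vec_def by simp linarith
  fix m assume m: "\<beta> - lattice_vec m \<in> unit_cube"
  show "m = (\<chi> i. \<lfloor>\<beta> $ i\<rfloor>)"
  proof (subst vec_eq_iff, intro allI)
    fix i
    have "0 \<le> \<beta> $ i - of_int (m $ i)" "\<beta> $ i - of_int (m $ i) < 1"
      using m unfolding unit_cube_def lattice_vec_def by auto
    then have "\<lfloor>\<beta> $ i\<rfloor> = m $ i" by linarith
    then show "m $ i = (\<chi> i. \<lfloor>\<beta> $ i\<rfloor>) $ i" by simp
  qed
qed

lemma emeasure_tiling:
  fixes u :: "real ^ 'n"
  assumes B: "B \<in> sets borel"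
  shows "emeasure lborel B = (\<integral>\<^sup>+m. emeasure lborel {\<alpha> \<in> B. \<alpha> + u - lattice_vec m \<in> unit_cube} \<partial>count_space UNIV)"
proof -
  let ?X = "\<lambda>m. {\<alpha> \<in> B. \<alpha> + u - lattice_vec m \<in> unit_cube}"
  have meas: "?X m \<in> sets lborel" for m using B by measurable
  have "\<exists>m. \<alpha> + u - lattice_vec m \<in> unit_cube" for \<alpha>
    using unit_cube_tiling[of "\<alpha> + u"] by auto
  then have "B = (\<Union>m. ?X m)" by auto
  moreover have "m = m'" if "\<alpha> + u - lattice_vec m \<in> unit_cube" "\<alpha> + u - lattice_vec m' \<in> unit_cube" for \<alpha> m m'
    using unit_cube_tiling[of "\<alpha> + u"] that by auto
  then have "disjoint_family ?X" unfolding disjoint_family_on_def by auto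
  ultimately show ?thesis
    using emeasure_UN_countable[of UNIV ?X lborel] meas by auto
qed

text \<open>The shifted cube is cut along the lattice and its pieces are moved back by lattice
  vectors; they reassemble to the original cube, and a periodic set does not notice the
  move.\<close>

lemma emeasure_torus_shift:
  fixes u :: "real ^ 'n"
  assumes A: "A \<in> sets borel" and per: "periodic A"
  shows "emeasure torus {\<alpha>. \<alpha> + u \<in> A} = emeasure torus A"
proof -
  let ?B = "{\<beta> \<in> A. \<beta> - u \<in> unit_cube}"
  have B[measurable]: "?B \<in> sets borel" using A by measurable
  have "emeasure torus {\<alpha>. \<alpha> + u \<in> A} = emeasure lborel (unit_cube \<inter> {\<alpha>. \<alpha> + u \<in> A})"
    by (rule emeasure_torus) (use A in measurable)
  also have "unit_cube \<inter> {\<alpha>. \<alpha> + u \<in> A} = {\<alpha>. \<alpha> + u \<in> ?B}" by auto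
  also have "emeasure lborel \<dots> = emeasure lborel ?B" by (rule emeasure_lborel_translate[OF B])
  also have "\<dots> = (\<integral>\<^sup>+m. emeasure lborel {\<alpha> \<in> ?B. \<alpha> + 0 - lattice_vec m \<in> unit_cube} \<partial>count_space UNIV)"
    by (rule emeasure_tiling[OF B])
  also have "\<dots> = (\<integral>\<^sup>+m. emeasure lborel {\<alpha> \<in> unit_cube \<inter> A. \<alpha> + u - lattice_vec m \<in> unit_cube} \<partial>count_space UNIV)"
  proof -
    \<comment> \<open>Translation by the lattice vector of m preserves both \<open>A\<close> and
      Lebesgue measure. The sign of m is arranged so that the tiling for the shift - u
      applies.\<close>
    have "emeasure lborel {\<alpha> \<in> ?B. \<alpha> + 0 - lattice_vec m \<in> unit_cube}
        = emeasure lborel {\<alpha> \<in> unit_cube \<inter> A. \<alpha> - u - lattice_vec (- m) \<in> unit_cube}" for m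
    proof -
      have C: "{\<alpha> \<in> ?B. \<alpha> + 0 - lattice_vec m \<in> unit_cube} \<in> sets borel" by measurable
      have lm: "lattice_vec (- m) = - lattice_vec m" by (simp add: lattice_vec_def vec_eq_iff)
      have "{\<alpha>. \<alpha> + lattice_vec m \<in> {\<alpha> \<in> ?B. \<alpha> + 0 - lattice_vec m \<in> unit_cube}}
          = {\<alpha> \<in> unit_cube \<inter> A. \<alpha> - u - lattice_vec (- m) \<in> unit_cube}"
      proof -
        have "\<alpha> + lattice_vec m \<in> A \<longleftrightarrow> \<alpha> \<in> A" for \<alpha> using per by (simp add: periodic_def)
        moreover have "\<alpha> + lattice_vec m - u = \<alpha> - u - lattice_vec (- m)" for \<alpha> by (simp add: lm)
        ultimately show ?thesis
          by (auto simp only: mem_Collect_eq Int_iff add_0_right add_diff_cancel_right')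
      qed
      then show ?thesis using emeasure_lborel_translate[OF C, of "lattice_vec m"] by simp
    qed
    then have "(\<integral>\<^sup>+m. emeasure lborel {\<alpha> \<in> ?B. \<alpha> + 0 - lattice_vec m \<in> unit_cube} \<partial>count_space UNIV)
       = (\<integral>\<^sup>+m. emeasure lborel {\<alpha> \<in> unit_cube \<inter> A. \<alpha> - u - lattice_vec (- m) \<in> unit_cube} \<partial>count_space UNIV)"
      by simp
    also have "\<dots> = (\<integral>\<^sup>+m. emeasure lborel {\<alpha> \<in> unit_cube \<inter> A. \<alpha> - u - lattice_vec m \<in> unit_cube} \<partial>count_space UNIV)"
      by (rule nn_integral_bij_count_space[where g = "\<lambda>m. - m"]) (auto intro!: bij_betwI[where g = uminus])
    also have "\<dots> = emeasure lborel (unit_cube \<inter> A)"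
      using emeasure_tiling[of "unit_cube \<inter> A" "- u"] A by simp
    also have "\<dots> = (\<integral>\<^sup>+m. emeasure lborel {\<alpha> \<in> unit_cube \<inter> A. \<alpha> + u - lattice_vec m \<in> unit_cube} \<partial>count_space UNIV)"
      using emeasure_tiling[of "unit_cube \<inter> A" "u"] A by simp
    finally show ?thesis .
  qed
  also have "\<dots> = emeasure lborel (unit_cube \<inter> A)"
    using emeasure_tiling[of "unit_cube \<inter> A" "u"] A by simp
  also have "\<dots> = emeasure torus A" by (rule emeasure_torus[OF A, symmetric])
  finally show ?thesis .
qed

lemma periodic_Int: "periodic A \<Longrightarrow> periodic B \<Longrightarrow> periodic (A \<inter> B)"
  by (simp add: periodic_def)

lemma measure_torus_shift:
  "A \<in> sets borel \<Longrightarrow> periodic A \<Longrightarrow> measure torus {\<alpha>. \<alpha> + u \<in> A} = measure torus A"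
  by (simp add: measure_def emeasure_torus_shift)

text \<open>A discrete Fubini argument in the direction u: the shifted copies of
  \<open>G \<inter> A\<close> all have the same measure, and a point of \<open>G\<close> lies in at
  most c of the B copies.\<close>

lemma measure_torus_average:
  fixes u :: "real ^ 'n" and c :: real
  assumes [measurable]: "G \<in> sets borel" "A \<in> sets borel"
    and per: "periodic G" "periodic A" and B: "0 < B"
    and inv: "\<And>\<alpha> i. i < B \<Longrightarrow> \<alpha> + real i *\<^sub>R u \<in> G \<longleftrightarrow> \<alpha> \<in> G"
    and cnt: "\<And>\<alpha>. real (card {i. i < B \<and> \<alpha> + real i *\<^sub>R u \<in> A}) \<le> c"
  shows "measure torus (G \<inter> A) \<le> measure torus G * (c / real B)"
proof -
  interpret prob_space torus by (rule prob_space_torus)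
  let ?A = "\<lambda>i. G \<inter> {\<alpha>. \<alpha> + real i *\<^sub>R u \<in> A}"
  have [measurable]: "?A i \<in> sets borel" for i by measurable
  have int: "integrable torus (indicat_real X)" if "X \<in> sets borel" for X
    using that by (simp add: integrable_indicator_iff less_top[symmetric])
  have eq: "prob (?A i) = prob (G \<inter> A)" if "i < B" for i
  proof -
    have "?A i = {\<alpha>. \<alpha> + real i *\<^sub>R u \<in> G \<inter> A}" using inv[OF that] by auto
    then show ?thesis using measure_torus_shift[of "G \<inter> A" "real i *\<^sub>R u"] per
      by (simp add: periodic_Int)
  qed
  have "real B * prob (G \<inter> A) = (\<Sum>i<B. prob (?A i))" by (simp add: eq)
  also have "\<dots> = (\<Sum>i<B. expectation (indicator (?A i)))" by simp
  also have "\<dots> = expectation (\<lambda>\<alpha>. \<Sum>i<B. indicator (?A i) \<alpha>)"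
    by (subst Bochner_Integration.integral_sum) (auto intro: int)
  also have "\<dots> \<le> expectation (\<lambda>\<alpha>. c * indicator G \<alpha>)"
  proof (rule integral_mono)
    fix \<alpha> :: "real ^ 'n"
    have "(\<Sum>i<B. indicator (?A i) \<alpha>) = indicator G \<alpha> * (\<Sum>i<B. if \<alpha> + real i *\<^sub>R u \<in> A then 1 else (0::real))"
      unfolding sum_distrib_left by (rule sum.cong) (auto simp: indicator_def)
    also have "(\<Sum>i<B. if \<alpha> + real i *\<^sub>R u \<in> A then 1 else (0::real)) = real (card {i. i < B \<and> \<alpha> + real i *\<^sub>R u \<in> A})"
    proof -
      have "{..<B} \<inter> {i. \<alpha> + real i *\<^sub>R u \<in> A} = {i. i < B \<and> \<alpha> + real i *\<^sub>R u \<in> A}" by auto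
      then show ?thesis by (simp add: sum.If_cases)
    qed
    also have "indicator G \<alpha> * \<dots> \<le> indicator G \<alpha> * c" using cnt by (intro mult_left_mono) auto
    finally show "(\<Sum>i<B. indicator (?A i) \<alpha>) \<le> c * indicator G \<alpha>" by (simp add: mult.commute)
  qed (auto intro!: int Bochner_Integration.integrable_sum integrable_mult_right)
  also have "\<dots> = c * prob G" by simp
  finally show ?thesis using B by (simp add: field_simps)
qed

text \<open>A set that is invariant along a direction on which an integral functional does not vanish is
  independent of the character of the torus defined by that functional. Averaging over finitely many
  shifts in this direction reduces the computation to counting.\<close>

definition integral_functional :: "(real ^ 'n \<Rightarrow> real) \<Rightarrow> bool" where
  "integral_functional \<phi> \<longleftrightarrow> linear \<phi> \<and> (\<forall>m. \<phi> (lattice_vec m) \<in> \<int>)"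

lemma integral_functional_measurable:
  "integral_functional \<phi> \<Longrightarrow> \<phi> \<in> borel_measurable borel"
  unfolding integral_functional_def
  by (intro borel_measurable_continuous_onI linear_continuous_on) (simp add: linear_conv_bounded_linear)

lemma integral_functional_scale:
  "integral_functional \<phi> \<Longrightarrow> integral_functional (\<lambda>\<alpha>. real a * \<phi> \<alpha>)"
  unfolding integral_functional_def
  by (auto intro!: Ints_mult linearI simp: linear_add linear_scale algebra_simps)

lemma sets_dnint_le:
  assumes "integral_functional \<phi>"
  shows "{\<alpha>. dnint (\<phi> \<alpha> + y) \<le> s} \<in> sets borel"
proof -
  note [measurable] = integral_functional_measurable[OF assms]
  show ?thesis by measurable
qed

lemma periodic_dnint_le:
  assumes "integral_functional \<phi>"
  shows "periodic {\<alpha>. dnint (\<phi> \<alpha> + y) \<le> s}"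
proof -
  have "dnint (\<phi> (\<alpha> + lattice_vec m) + y) = dnint (\<phi> \<alpha> + y)" for \<alpha> m
  proof -
    have "\<phi> (\<alpha> + lattice_vec m) + y = (\<phi> \<alpha> + y) + \<phi> (lattice_vec m)"
      using assms by (simp add: integral_functional_def linear_add)
    moreover have "\<phi> (lattice_vec m) \<in> \<int>" using assms by (simp add: integral_functional_def)
    ultimately show ?thesis by (simp only: dnint_add_Ints)
  qed
  then show ?thesis by (simp add: periodic_def)
qed

text \<open>Under shifts by u / B the functional runs through a progression of step 1 / B, of whose
  B terms at most 2 * s * B + 1 are close to an integer. The surplus 1 disappears as B
  grows.\<close>

lemma measure_torus_dnint_le_upper:
  assumes G: "G \<in> sets borel" "periodic G"
    and inv: "\<And>\<alpha> \<tau>. \<alpha> + \<tau> *\<^sub>R u \<in> G \<longleftrightarrow> \<alpha> \<in> G"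
    and \<phi>: "integral_functional \<phi>" "\<phi> u = 1" and s: "0 \<le> s"
  shows "measure torus (G \<inter> {\<alpha>. dnint (\<phi> \<alpha> + y) \<le> s}) \<le> measure torus G * (2 * s)"
proof (rule field_le_epsilon)
  fix e :: real assume e: "0 < e"
  obtain B :: nat where B: "1 / e < real B" using reals_Archimedean2 by blast
  have "0 < 1 / e" using e by simp
  then have B0: "0 < real B" using B by linarith
  then have B0': "0 < B" by simp
  have "measure torus (G \<inter> {\<alpha>. dnint (\<phi> \<alpha> + y) \<le> s}) \<le> measure torus G * ((2 * s * real B + 1) / real B)"
  proof (rule measure_torus_average[where u = "(1 / real B) *\<^sub>R u"])
    fix \<alpha>
    have "\<phi> (\<alpha> + real i *\<^sub>R (1 / real B) *\<^sub>R u) + y = (\<phi> \<alpha> + y) + real 1 * real i / real B" for i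
      using \<phi> by (simp add: integral_functional_def linear_add linear_scale)
    then show "real (card {i. i < B \<and> \<alpha> + real i *\<^sub>R (1 / real B) *\<^sub>R u \<in> {\<alpha>. dnint (\<phi> \<alpha> + y) \<le> s}}) \<le> 2 * s * real B + 1"
      using card_dnint_progression_le[OF B0' _ s, of 1 "\<phi> \<alpha> + y"] by (simp only: mem_Collect_eq) simp
  next
    fix \<alpha> i
    show "\<alpha> + real i *\<^sub>R (1 / real B) *\<^sub>R u \<in> G \<longleftrightarrow> \<alpha> \<in> G"
      using inv[of \<alpha> "real i / real B"] by simp
  qed (use G B0' sets_dnint_le periodic_dnint_le \<phi> in auto)
  also have "\<dots> = measure torus G * (2 * s) + measure torus G * (1 / real B)"
    using B0 by (simp add: field_simps)
  also have "measure torus G * (1 / real B) \<le> 1 * e"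
  proof (rule mult_mono)
    show "measure torus G \<le> 1" using prob_space.prob_le_1[OF prob_space_torus] .
    show "1 / real B \<le> e" using B B0 e by (simp add: field_simps)
  qed (use e in auto)
  finally show "measure torus (G \<inter> {\<alpha>. dnint (\<phi> \<alpha> + y) \<le> s}) \<le> measure torus G * (2 * s) + e" by simp
qed

text \<open>Equality results from using the upper bound twice: for the set itself and for the
  neighbourhood of the half-integers that covers the rest of \<open>G\<close>.\<close>

lemma measure_torus_dnint_le:
  assumes G: "G \<in> sets borel" "periodic G"
    and inv: "\<And>\<alpha> \<tau>. \<alpha> + \<tau> *\<^sub>R u \<in> G \<longleftrightarrow> \<alpha> \<in> G"
    and \<phi>: "integral_functional \<phi>" "\<phi> u = 1" and s: "0 \<le> s" "s \<le> 1 / 2"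
  shows "measure torus (G \<inter> {\<alpha>. dnint (\<phi> \<alpha>) \<le> s}) = measure torus G * (2 * s)"
proof (rule antisym)
  interpret prob_space torus by (rule prob_space_torus)
  let ?A = "{\<alpha>. dnint (\<phi> \<alpha>) \<le> s}" and ?A' = "{\<alpha>. dnint (\<phi> \<alpha> + 1 / 2) \<le> 1 / 2 - s}"
  show "prob (G \<inter> ?A) \<le> prob G * (2 * s)"
    using measure_torus_dnint_le_upper[OF G inv \<phi> s(1), of 0] by simp
  have [measurable]: "?A \<in> sets borel" "?A' \<in> sets borel" "G \<in> sets borel"
    using sets_dnint_le[OF \<phi>(1), of 0] sets_dnint_le[OF \<phi>(1)] G by auto
  have "G \<subseteq> (G \<inter> ?A) \<union> (G \<inter> ?A')" 
    using dnint_add_half_le by (auto simp: not_le) (meson linorder_not_le)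
  then have "prob G \<le> prob ((G \<inter> ?A) \<union> (G \<inter> ?A'))" by (intro finite_measure_mono) auto
  also have "\<dots> \<le> prob (G \<inter> ?A) + prob (G \<inter> ?A')" by (rule measure_Un_le) auto
  also have "prob (G \<inter> ?A') \<le> prob G * (2 * (1 / 2 - s))"
    using measure_torus_dnint_le_upper[OF G inv \<phi>, of "1 / 2 - s" "1 / 2"] s by simp
  finally show "prob G * (2 * s) \<le> prob (G \<inter> ?A)" by (simp add: algebra_simps)
qed

text \<open>A shift by u / a leaves a * \<phi> unchanged modulo 1, so the first condition can be
  joined to the invariant set, while b * \<phi> visits the multiples of 1 / a. The rounding error of
  this count is the term 1 / a, the price of dependence.\<close>

lemma measure_torus_dnint_le_pair:
  fixes a b :: nat
  assumes G: "G \<in> sets borel" "periodic G"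
    and inv: "\<And>\<alpha> \<tau>. \<alpha> + \<tau> *\<^sub>R u \<in> G \<longleftrightarrow> \<alpha> \<in> G"
    and \<phi>: "integral_functional \<phi>" "\<phi> u = 1"
    and s: "0 \<le> s" "s \<le> 1 / 2" "0 \<le> t" and ab: "0 < a" "coprime a b"
  shows "measure torus (G \<inter> {\<alpha>. dnint (real a * \<phi> \<alpha>) \<le> s} \<inter> {\<alpha>. dnint (real b * \<phi> \<alpha>) \<le> t})
    \<le> measure torus G * (2 * s * (2 * t + 1 / real a))"
proof -
  note \<phi>a = integral_functional_scale[OF \<phi>(1), of a] and \<phi>b = integral_functional_scale[OF \<phi>(1), of b]
  let ?A = "{\<alpha>. dnint (real a * \<phi> \<alpha>) \<le> s}" and ?B = "{\<alpha>. dnint (real b * \<phi> \<alpha>) \<le> t}"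
  have sh: "real c * \<phi> (\<alpha> + real i *\<^sub>R (1 / real a) *\<^sub>R u) = real c * \<phi> \<alpha> + real c * real i / real a" for c \<alpha> i
    using \<phi> by (simp add: integral_functional_def linear_add linear_scale algebra_simps)
  have "measure torus ((G \<inter> ?A) \<inter> ?B) \<le> measure torus (G \<inter> ?A) * ((2 * t * real a + 1) / real a)"
  proof (rule measure_torus_average[where u = "(1 / real a) *\<^sub>R u"])
    fix \<alpha>
    show "real (card {i. i < a \<and> \<alpha> + real i *\<^sub>R (1 / real a) *\<^sub>R u \<in> ?B}) \<le> 2 * t * real a + 1"
      using card_dnint_progression_le[OF ab s(3), of "real b * \<phi> \<alpha>"] by (simp only: sh mem_Collect_eq)
  next
    fix \<alpha> i
    have "\<alpha> + real i *\<^sub>R (1 / real a) *\<^sub>R u \<in> G \<longleftrightarrow> \<alpha> \<in> G"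
      using inv[of \<alpha> "real i / real a"] by simp
    moreover have "dnint (real a * \<phi> \<alpha> + real a * real i / real a) = dnint (real a * \<phi> \<alpha>)"
      using ab by (subst dnint_add_Ints) auto
    ultimately show "\<alpha> + real i *\<^sub>R (1 / real a) *\<^sub>R u \<in> G \<inter> ?A \<longleftrightarrow> \<alpha> \<in> G \<inter> ?A" by (simp only: sh mem_Collect_eq Int_iff)
  qed (use G ab sets_dnint_le[OF \<phi>a, of 0] periodic_dnint_le[OF \<phi>a, of 0]
        sets_dnint_le[OF \<phi>b, of 0] periodic_dnint_le[OF \<phi>b, of 0] in \<open>auto intro: periodic_Int\<close>)
  also have "measure torus (G \<inter> ?A) = measure torus G * (2 * s)"
  proof (rule measure_torus_dnint_le[OF G _ \<phi>a])
    show "\<alpha> + \<tau> *\<^sub>R ((1 / real a) *\<^sub>R u) \<in> G \<longleftrightarrow> \<alpha> \<in> G" for \<alpha> \<tau>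
      using inv[of \<alpha> "\<tau> / real a"] by simp
    show "real a * \<phi> ((1 / real a) *\<^sub>R u) = 1"
      using \<phi> ab by (simp add: integral_functional_def linear_scale)
  qed (use s in auto)
  also have "(2 * t * real a + 1) / real a = 2 * t + 1 / real a" using ab by (simp add: field_simps)
  finally show ?thesis by (simp add: mult.assoc)
qed

text \<open>Countably many lattice translates of a null set cover the exceptional set.\<close>

lemma AE_lborel_if_AE_torus:
  assumes per: "\<And>\<alpha> m. P (\<alpha> + lattice_vec m) \<longleftrightarrow> P \<alpha>"
    and ae: "AE \<alpha> in torus. P \<alpha>"
  shows "AE \<alpha> in lborel. P \<alpha>"
proof -
  have "AE \<alpha> in lborel. \<alpha> \<in> unit_cube \<longrightarrow> P \<alpha>"
    using ae unfolding torus_def by (subst (asm) AE_uniform_measure) auto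
  then obtain N where N: "N \<in> null_sets lborel" "{\<alpha>. \<not> (\<alpha> \<in> unit_cube \<longrightarrow> P \<alpha>)} \<subseteq> N"
    by (auto elim!: AE_E simp: null_sets_def)
  have "(\<Union>m. {\<alpha>. \<alpha> - lattice_vec m \<in> N}) \<in> null_sets lborel"
    by (intro null_sets_UN null_sets_translation N)
  moreover have "{\<alpha>. \<not> P \<alpha>} \<subseteq> (\<Union>m. {\<alpha>. \<alpha> - lattice_vec m \<in> N})"
  proof
    fix \<alpha> assume "\<alpha> \<in> {\<alpha>. \<not> P \<alpha>}"
    moreover obtain m where m: "\<alpha> - lattice_vec m \<in> unit_cube" using unit_cube_tiling[of \<alpha>] by auto
    moreover have "P \<alpha> \<longleftrightarrow> P (\<alpha> - lattice_vec m)" using per[of "\<alpha> - lattice_vec m" m] by simp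
    ultimately have "\<alpha> - lattice_vec m \<in> N" using N(2) by auto
    then show "\<alpha> \<in> (\<Union>m. {\<alpha>. \<alpha> - lattice_vec m \<in> N})" by auto
  qed
  ultimately show ?thesis by (auto intro: AE_I')
qed

subsection \<open>Dyadic levels\<close>

definition level :: "nat \<Rightarrow> ('r::finite \<Rightarrow> nat) set" where
  "level s = {j. sum j UNIV = s}"

definition levels :: "nat \<Rightarrow> ('r::finite \<Rightarrow> nat) set" where
  "levels J = {j. sum j UNIV < J}"

lemma le_sum_UNIV: "(j i :: nat) \<le> sum j (UNIV :: 'r::finite set)"
  by (rule member_le_sum) auto

lemma levels_subset: "levels J \<subseteq> PiE (UNIV :: 'r::finite set) (\<lambda>_. {..<J})"
proof
  fix j :: "'r \<Rightarrow> nat" assume "j \<in> levels J"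
  then have "j i < J" for i using le_sum_UNIV[of j i] by (simp add: levels_def)
  then show "j \<in> PiE UNIV (\<lambda>_. {..<J})" by auto
qed

lemma finite_levels [simp]: "finite (levels J :: ('r::finite \<Rightarrow> nat) set)"
  by (rule finite_subset[OF levels_subset]) (auto intro: finite_PiE)

lemma finite_level [simp]: "finite (level s :: ('r::finite \<Rightarrow> nat) set)"

proof (rule finite_subset)
  show "level s \<subseteq> (levels (Suc s) :: ('r \<Rightarrow> nat) set)" by (auto simp: level_def levels_def)
qed simp

lemma card_levels_le: "card (levels J :: ('r::finite \<Rightarrow> nat) set) \<le> J ^ CARD('r)"
  using card_mono[OF _ levels_subset[of J, where 'r = 'r]] by (simp add: finite_PiE card_PiE)

text \<open>The simplex contains a cube of side \<open>J div CARD('r)\<close>.\<close>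

lemma card_levels_ge: "(J div CARD('r)) ^ CARD('r) \<le> card (levels J :: ('r::finite \<Rightarrow> nat) set)"
proof -
  let ?t = "J div CARD('r)"
  have "PiE (UNIV :: 'r set) (\<lambda>_. {..<?t}) \<subseteq> levels J"
  proof
    fix j :: "'r \<Rightarrow> nat" assume "j \<in> PiE UNIV (\<lambda>_. {..<?t})"
    then have j: "j i < ?t" for i by auto
    have "sum j UNIV < (\<Sum>i\<in>(UNIV::'r set). ?t)" by (rule sum_strict_mono) (use j in auto)
    also have "\<dots> \<le> J" by simp
    finally show "j \<in> levels J" by (simp add: levels_def)
  qed
  from card_mono[OF finite_levels this] show ?thesis by (simp add: card_PiE)
qed

text \<open>On a layer one entry is determined by the others, which saves one power of s. This
  saving is what makes the transition range negligible.\<close>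

lemma card_level_le: "card (level s :: ('r::finite \<Rightarrow> nat) set) \<le> (s + 1) ^ (CARD('r) - 1)"
proof -
  obtain i0 :: 'r where True by blast
  let ?f = "\<lambda>j. restrict j (UNIV - {i0})"
  have split: "sum j UNIV = j i0 + sum j (UNIV - {i0})" for j :: "'r \<Rightarrow> nat"
    by (rule sum.remove) auto
  have "inj_on ?f (level s)"
  proof (rule inj_onI, rule ext)
    fix j l :: "'r \<Rightarrow> nat" and i assume jl: "j \<in> level s" "l \<in> level s" and eq: "?f j = ?f l"
    have *: "j i = l i" if "i \<noteq> i0" for i using fun_cong[OF eq, of i] that by simp
    then have "sum j (UNIV - {i0}) = sum l (UNIV - {i0})" by (intro sum.cong) auto
    then have "j i0 = l i0" using jl split[of j] split[of l] by (simp add: level_def)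
    with * show "j i = l i" by (cases "i = i0") auto
  qed
  then have "card (level s :: ('r \<Rightarrow> nat) set) = card (?f ` level s)" by (simp add: card_image)
  also have "\<dots> \<le> card (PiE (UNIV - {i0}) (\<lambda>_. {..s}))"
  proof (intro card_mono finite_PiE)
    show "?f ` level s \<subseteq> PiE (UNIV - {i0}) (\<lambda>_. {..s})"
      by (auto simp: level_def PiE_def le_sum_UNIV split: if_splits)
  qed auto
  also have "\<dots> = (s + 1) ^ (CARD('r) - 1)" by (simp add: card_PiE)
  finally show ?thesis .
qed

text \<open>Since \<open>deep\<close> is inherited by smaller indices, this reduces excluding all
  multi-indices of large sum to excluding those on a single layer.\<close>

lemma level_below:
  fixes j :: "'r::finite \<Rightarrow> nat"
  assumes "s \<le> sum j UNIV"
  shows "\<exists>l. (\<forall>i. l i \<le> j i) \<and> sum l UNIV = s"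
  using assms
proof (induction s)
  case 0
  show ?case by (intro exI[of _ "\<lambda>_. 0"]) auto
next
  case (Suc s)
  then obtain l where l: "\<And>i. l i \<le> j i" "sum l UNIV = s" by auto
  have "\<exists>i. l i < j i"
  proof (rule ccontr)
    assume "\<not> (\<exists>i. l i < j i)"
    then have "sum j UNIV \<le> sum l UNIV" by (intro sum_mono) (auto simp: not_less)
    then show False using l Suc by simp
  qed
  then obtain i0 where i0: "l i0 < j i0" by blast
  let ?l = "l(i0 := Suc (l i0))"
  have "sum ?l UNIV = Suc (l i0) + sum ?l (UNIV - {i0})" by (subst sum.remove[of _ i0]) auto
  also have "sum ?l (UNIV - {i0}) = sum l (UNIV - {i0})" by (rule sum.cong) auto
  finally have "sum ?l UNIV = Suc s" using l(2) by (simp add: sum.remove[of UNIV i0])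
  then show ?case using l(1) i0 by (intro exI[of _ ?l]) auto
qed

text \<open>Up to constants, 1 / dnint y is the sum of 2 ^ j over all j with deep j y, and for uniformly
  distributed y the predicate deep j y has probability exactly 2 ^ - j.\<close>

definition deep :: "nat \<Rightarrow> real \<Rightarrow> bool" where
  "deep j y \<longleftrightarrow> 2 ^ (j + 1) * dnint y \<le> 1"

lemma deep_mono: "j \<le> l \<Longrightarrow> deep l y \<Longrightarrow> deep j y"
  unfolding deep_def
  by (meson add_le_mono1 dnint_nonneg mult_right_mono one_le_numeral order_trans power_increasing)

text \<open>If j is the deepest level present, the geometric sum stays below 2 ^ (j + 1), and
  \<open>deep\<close> bounds that power by the reciprocal.\<close>

lemma deep_sum_le:
  assumes "0 < dnint y"
  shows "(\<Sum>j<J. if deep j y then 2 ^ j else 0) \<le> 1 / dnint y"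
proof (cases "\<exists>j<J. deep j y")
  case False
  then have "(\<Sum>j<J. if deep j y then 2 ^ j else (0::real)) = 0" by (intro sum.neutral) auto
  then show ?thesis using assms by simp
next
  case True
  define j0 where "j0 = Max {j. j < J \<and> deep j y}"
  have "finite {j. j < J \<and> deep j y}" by simp
  then have j0: "j0 < J" "deep j0 y" and mx: "\<And>j. j < J \<Longrightarrow> deep j y \<Longrightarrow> j \<le> j0"
    using True Max_in[of "{j. j < J \<and> deep j y}"] by (auto simp: j0_def)
  have "(\<Sum>j<J. if deep j y then 2 ^ j else (0::real)) = (\<Sum>j\<in>{..<J} \<inter> {j. deep j y}. 2 ^ j)"
    by (simp add: sum.If_cases)
  also have "\<dots> \<le> (\<Sum>j<Suc j0. 2 ^ j)" by (rule sum_mono2) (use mx in \<open>auto simp: less_Suc_eq_le\<close>)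
  also have "\<dots> \<le> 2 ^ (j0 + 1)" by (subst geometric_sum) auto
  also have "\<dots> \<le> 1 / dnint y" using j0 assms by (simp add: deep_def field_simps)
  finally show ?thesis .
qed

lemma deepest:
  assumes "0 < dnint y"
  shows "\<exists>j. deep j y \<and> 1 / dnint y \<le> 4 * 2 ^ j"
proof -
  \<comment> \<open>The deepest level is n - 2: \<open>deep j\<close> tests the exponent j + 1, and
    n is the first exponent that fails. That n is at least 2 follows from
    \<open>dnint_le_half\<close>.\<close>
  define n where "n = (LEAST n. 1 < 2 ^ n * dnint y)"
  obtain N where "1 / dnint y < 2 ^ N" using real_arch_pow[of 2 "1 / dnint y"] by auto
  then have "1 < 2 ^ N * dnint y" using assms by (simp add: field_simps)
  then have n: "1 < 2 ^ n * dnint y" unfolding n_def by (rule LeastI)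
  have min: "2 ^ k * dnint y \<le> 1" if "k < n" for k
    using not_less_Least[of k "\<lambda>n. 1 < 2 ^ n * dnint y"] that unfolding n_def by auto
  have "n \<noteq> 0" "n \<noteq> 1" using n dnint_le_half[of y] by (auto intro!: notI gr0I)
  then obtain j where j: "n = Suc (Suc j)" by (metis One_nat_def not0_implies_Suc)
  show ?thesis
  proof (intro exI conjI)
    show "deep j y" using min[of "Suc j"] j by (simp add: deep_def)
    show "1 / dnint y \<le> 4 * 2 ^ j" using n j assms by (simp add: field_simps)
  qed
qed

text \<open>Indicators and powers factor over the coordinates, so the sum over the simplex is a part
  of the expanded product of one-dimensional sums over a cube.\<close>

lemma levels_sum_le_prod:
  fixes y :: "'r::finite \<Rightarrow> real"
  assumes "\<And>i. 0 < dnint (y i)"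
  shows "(\<Sum>j\<in>levels J. if \<forall>i. deep (j i) (y i) then 2 ^ sum j UNIV else 0) \<le> (\<Prod>i\<in>UNIV. 1 / dnint (y i))"
proof -
  let ?g = "\<lambda>i j. if deep j (y i) then 2 ^ j else (0::real)"
  have eq: "(if \<forall>i. deep (j i) (y i) then 2 ^ sum j UNIV else 0) = (\<Prod>i\<in>UNIV. ?g i (j i))" for j
  proof (cases "\<forall>i. deep (j i) (y i)")
    case True
    then show ?thesis by (simp add: power_sum)
  next
    case False
    then obtain i where "\<not> deep (j i) (y i)" by blast
    then have "(\<Prod>i\<in>UNIV. ?g i (j i)) = 0" by (intro prod_zero) auto
    then show ?thesis using False by (simp only: if_False)
  qed
  have "(\<Sum>j\<in>levels J. if \<forall>i. deep (j i) (y i) then 2 ^ sum j UNIV else 0) = (\<Sum>j\<in>levels J. \<Prod>i\<in>UNIV. ?g i (j i))"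
    by (simp only: eq)
  also have "\<dots> \<le> (\<Sum>j\<in>PiE UNIV (\<lambda>_. {..<J}). \<Prod>i\<in>UNIV. ?g i (j i))"
    by (rule sum_mono2[OF _ levels_subset]) (auto intro!: prod_nonneg finite_PiE)
  also have "\<dots> = (\<Prod>i\<in>UNIV. \<Sum>j<J. ?g i j)" by (rule prod_sum_PiE[symmetric]) auto
  also have "\<dots> \<le> (\<Prod>i\<in>UNIV. 1 / dnint (y i))"
    by (rule prod_mono) (auto intro!: sum_nonneg deep_sum_le assms)
  finally show ?thesis .
qed

text \<open>The multi-index of deepest levels alone carries the product, up to a factor 4 per
  coordinate. It lies in \<open>levels J\<close>, since otherwise a smaller multi-index on the layer
  J would contradict \<open>top\<close>.\<close>

lemma prod_le_levels_sum:
  fixes y :: "'r::finite \<Rightarrow> real"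
  assumes pos: "\<And>i. 0 < dnint (y i)" and top: "\<And>j. j \<in> level J \<Longrightarrow> \<exists>i. \<not> deep (j i) (y i)"
  shows "(\<Prod>i\<in>UNIV. 1 / dnint (y i)) \<le> 4 ^ CARD('r) * (\<Sum>j\<in>levels J. if \<forall>i. deep (j i) (y i) then 2 ^ sum j UNIV else 0)"
proof -
  obtain j where j: "\<And>i. deep (j i) (y i)" "\<And>i. 1 / dnint (y i) \<le> 4 * 2 ^ j i"
    using deepest[OF pos] by metis
  have mem: "j \<in> levels J"
  proof (rule ccontr)
    assume "j \<notin> levels J"
    then have "J \<le> sum j UNIV" by (simp add: levels_def)
    then obtain l where "\<And>i. l i \<le> j i" and l: "sum l UNIV = J" using level_below by blast
    then have "deep (l i) (y i)" for i using deep_mono j(1) by blast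
    then show False using top[of l] l by (auto simp: level_def)
  qed
  have "(\<Prod>i\<in>UNIV. 1 / dnint (y i)) \<le> (\<Prod>i\<in>(UNIV::'r set). 4 * 2 ^ j i)"
    by (rule prod_mono) (use j in auto)
  also have "\<dots> = 4 ^ CARD('r) * 2 ^ sum j UNIV" by (simp add: prod.distrib power_sum)
  also have "2 ^ sum j UNIV \<le> (\<Sum>j\<in>levels J. if \<forall>i. deep (j i) (y i) then 2 ^ sum j UNIV else (0::real))"
    using member_le_sum[OF mem, of "\<lambda>j. if \<forall>i. deep (j i) (y i) then 2 ^ sum j UNIV else (0::real)"] j by auto
  finally show ?thesis by simp
qed

subsection \<open>Weights on boxes\<close>

definition weight :: "('m::finite \<Rightarrow> nat) \<Rightarrow> real" where
  "weight q = (\<Prod>i\<in>UNIV. 1 / max 1 (real (q i)))"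

text \<open>The critical depth of q: up to an additive constant it is the binary logarithm of 1 /
  \<open>weight q\<close>.\<close>

definition bits :: "('m::finite \<Rightarrow> nat) \<Rightarrow> nat" where
  "bits q = (\<Sum>i\<in>UNIV. floor_log (q i))"

text \<open>Doubly exponential box sizes: the expected growth is then geometric in k, which makes the
  exceptional probabilities summable, and passing to the next box costs only a constant factor.\<close>

definition qbox :: "('m::finite \<Rightarrow> nat) \<Rightarrow> ('m \<Rightarrow> nat) set" where
  "qbox k = {q. q \<noteq> (\<lambda>_. 0) \<and> (\<forall>i. q i < 2 ^ 2 ^ k i)}"

text \<open>The binary logarithms of the side lengths of the box are the numbers 2 ^ k i. Their sum
  \<open>bigL\<close> stands for the logarithm of the volume, and their product \<open>bigP\<close>
  is the order of the total weight.\<close>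

definition bigL :: "('m::finite \<Rightarrow> nat) \<Rightarrow> nat" where
  "bigL k = (\<Sum>i\<in>UNIV. 2 ^ k i)"

definition bigP :: "('m::finite \<Rightarrow> nat) \<Rightarrow> real" where
  "bigP k = 2 ^ sum k UNIV"

lemma qbox_subset: "qbox k \<subseteq> PiE UNIV (\<lambda>i. {..<2 ^ 2 ^ k i})"
  by (auto simp: qbox_def)

lemma finite_qbox [simp]: "finite (qbox k)"
  by (rule finite_subset[OF qbox_subset]) (auto intro: finite_PiE)

lemma weight_pos [simp]: "0 < weight q"
  unfolding weight_def by (intro prod_pos) auto

lemma weight_nonneg [simp]: "0 \<le> weight q"
  by (rule less_imp_le) simp

lemma bigP_ge_1: "1 \<le> bigP k"
  by (simp add: bigP_def)

lemma bigL_ge_1: "1 \<le> bigL (k :: 'm::finite \<Rightarrow> nat)"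
proof -
  obtain i0 :: 'm where True by blast
  have "1 \<le> (2::nat) ^ k i0" by simp
  also have "\<dots> \<le> bigL k" unfolding bigL_def by (rule member_le_sum) auto
  finally show ?thesis .
qed

lemma sum_le_bigL: "sum k UNIV \<le> bigL k"
  unfolding bigL_def by (rule sum_mono) (simp add: less_imp_le)

lemma power_le_bigL: "2 ^ k i \<le> bigL k"
  unfolding bigL_def by (rule member_le_sum) auto

lemma bigL_le: "real (bigL (k :: 'm::finite \<Rightarrow> nat)) \<le> real CARD('m) * bigP k"
proof -
  have "real (bigL k) = (\<Sum>i\<in>UNIV. 2 ^ k i)" by (simp add: bigL_def)
  also have "\<dots> \<le> (\<Sum>i\<in>(UNIV::'m set). bigP k)"
    unfolding bigP_def by (intro sum_mono power_increasing le_sum_UNIV) auto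
  finally show ?thesis by simp
qed

lemma bits_le_bigL:
  assumes "q \<in> qbox k"
  shows "bits q \<le> bigL k"
  unfolding bits_def bigL_def
proof (rule sum_mono)
  fix i
  have "q i < 2 ^ 2 ^ k i" using assms by (auto simp: qbox_def)
  then have "floor_log (q i) \<le> floor_log (2 ^ 2 ^ k i)" by (intro floor_log_le_iff) simp
  then show "floor_log (q i) \<le> 2 ^ k i" by simp
qed

lemma two_power_bits_le: "2 ^ bits q * weight q \<le> 1"
proof -
  have "2 ^ floor_log n \<le> max 1 (real n)" for n
  proof (cases "n = 0")
    case False
    then have "2 ^ floor_log n \<le> n" by (intro floor_log_exp2_le) simp
    then have "real (2 ^ floor_log n) \<le> real n" by (simp only: of_nat_le_iff)
    then show ?thesis by (simp add: le_max_iff_disj)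
  qed simp
  then have "(\<Prod>i\<in>UNIV. 2 ^ floor_log (q i) * (1 / max 1 (real (q i)))) \<le> (\<Prod>i\<in>(UNIV::'a set). 1)"
    by (intro prod_mono) (auto simp: field_simps)
  then show ?thesis by (simp add: bits_def weight_def power_sum prod.distrib prod_dividef)
qed

lemma two_power_bits_ge: "1 \<le> 2 ^ CARD('m) * (2 ^ bits q * weight (q :: 'm::finite \<Rightarrow> nat))"
proof -
  have "max 1 (real n) \<le> 2 * 2 ^ floor_log n" for n
  proof -
    have "n \<le> 2 * 2 ^ floor_log n" by (rule floor_log_exp2_ge)
    then have "real n \<le> real (2 * 2 ^ floor_log n)" by (simp only: of_nat_le_iff)
    moreover have "1 \<le> (2::real) * 2 ^ floor_log n" using one_le_power[of "2::real" "Suc (floor_log n)"] by simp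
    ultimately show ?thesis by simp
  qed
  then have "(\<Prod>i\<in>(UNIV::'m set). 1) \<le> (\<Prod>i\<in>UNIV. 2 * (2 ^ floor_log (q i) * (1 / max 1 (real (q i)))))"
    by (intro prod_mono) (auto simp: field_simps)
  then show ?thesis by (simp add: bits_def weight_def power_sum prod.distrib prod_dividef)
qed

section \<open>Harmonic sums and the total weight of a box\<close>

lemma harmonic_block_le: "(\<Sum>n\<in>{1..<2 ^ N}. 1 / real n) \<le> real N"
proof (induction N)
  case (Suc N)
  have "(\<Sum>n\<in>{1..<2 ^ Suc N}. 1 / real n) = (\<Sum>n\<in>{1..<2 ^ N}. 1 / real n) + (\<Sum>n\<in>{2 ^ N..<2 ^ Suc N}. 1 / real n)"
    by (intro sum.atLeastLessThan_concat[symmetric]) auto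
  also have "(\<Sum>n\<in>{2 ^ N..<2 ^ Suc N}. 1 / real n) \<le> (\<Sum>n\<in>{2 ^ N..<2 ^ Suc N::nat}. 1 / 2 ^ N)"
  proof (intro sum_mono divide_left_mono)
    fix n :: nat assume n: "n \<in> {2 ^ N..<2 ^ Suc N}"
    then have "0 < n" by (metis atLeastLessThan_iff less_le_trans zero_less_numeral zero_less_power)
    then show "0 < real n * 2 ^ N" by simp
    have "real (2 ^ N) \<le> real n" using n by (simp only: of_nat_le_iff) simp
    then show "2 ^ N \<le> real n" by simp
  qed simp
  also have "\<dots> = 1" by simp
  finally show ?case using Suc by simp
qed simp

lemma harmonic_block_ge:
  assumes "M \<le> N"
  shows "real (N - M) / 2 \<le> (\<Sum>n\<in>{2 ^ M..<2 ^ N}. 1 / real n)"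
  using assms
proof (induction N rule: dec_induct)
  case (step N)
  have "1 / 2 = (\<Sum>n\<in>{2 ^ N..<2 ^ Suc N::nat}. 1 / 2 ^ Suc N :: real)" by simp
  also have "\<dots> \<le> (\<Sum>n\<in>{2 ^ N..<2 ^ Suc N}. 1 / real n)"
  proof (intro sum_mono divide_left_mono)
    fix n :: nat assume n: "n \<in> {2 ^ N..<2 ^ Suc N}"
    then have "0 < n" by (metis atLeastLessThan_iff less_le_trans zero_less_numeral zero_less_power)
    then show "0 < 2 ^ Suc N * real n" by simp
    have "real n \<le> real (2 ^ Suc N)" using n by (simp only: of_nat_le_iff) simp
    then show "real n \<le> 2 ^ Suc N" by simp
  qed simp
  also have "(\<Sum>n\<in>{2 ^ M..<2 ^ N}. 1 / real n) + (\<Sum>n\<in>{2 ^ N..<2 ^ Suc N}. 1 / real n) = (\<Sum>n\<in>{2 ^ M..<2 ^ Suc N}. 1 / real n)"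
    using step by (intro sum.atLeastLessThan_concat) (auto intro!: power_increasing)
  ultimately show ?case using step by (simp add: Suc_diff_le)
qed simp

lemma sum_weight_le: "(\<Sum>q\<in>qbox (k :: 'm::finite \<Rightarrow> nat). weight q) \<le> 2 ^ CARD('m) * bigP k"
proof -
  have one: "(\<Sum>n<2 ^ N. 1 / max 1 (real n)) \<le> 1 + real N" for N
  proof -
    have "{..<2 ^ N} = insert 0 {1..<2 ^ N::nat}" by auto
    then have "(\<Sum>n<2 ^ N. 1 / max 1 (real n)) = 1 + (\<Sum>n\<in>{1..<2 ^ N}. 1 / max 1 (real n))" by simp
    also have "(\<Sum>n\<in>{1..<2 ^ N::nat}. 1 / max 1 (real n)) = (\<Sum>n\<in>{1..<2 ^ N}. 1 / real n)"
      by (rule sum.cong) auto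
    finally show ?thesis using harmonic_block_le[of N] by simp
  qed
  have "(\<Sum>q\<in>qbox k. weight q) \<le> (\<Sum>q\<in>PiE UNIV (\<lambda>i. {..<2 ^ 2 ^ k i}). weight q)"
    by (rule sum_mono2[OF _ qbox_subset]) (auto intro: finite_PiE less_imp_le)
  also have "\<dots> = (\<Prod>i\<in>UNIV. \<Sum>n<2 ^ 2 ^ k i. 1 / max 1 (real n))"
    unfolding weight_def by (rule prod_sum_PiE[symmetric]) auto
  also have "\<dots> \<le> (\<Prod>i\<in>UNIV. 2 * 2 ^ k i)"
  proof (rule prod_mono, intro conjI)
    fix i
    show "(\<Sum>n<2 ^ 2 ^ k i. 1 / max 1 (real n)) \<le> 2 * 2 ^ k i"
    proof -
      have "1 \<le> (2::real) ^ k i" by simp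
      moreover have "(\<Sum>n<2 ^ 2 ^ k i. 1 / max 1 (real n)) \<le> 1 + 2 ^ k i" using one[of "2 ^ k i"] by simp
      ultimately show ?thesis by linarith
    qed
  qed (auto intro!: sum_nonneg)
  also have "\<dots> = 2 ^ CARD('m) * bigP k" by (simp add: bigP_def prod.distrib power_sum)
  finally show ?thesis .
qed

subsection \<open>Summability and moments\<close>

lemma one_plus_sum_le_prod:
  fixes f :: "'a \<Rightarrow> real"
  assumes "finite A" "\<And>i. i \<in> A \<Longrightarrow> 0 \<le> f i"
  shows "1 + sum f A \<le> (\<Prod>i\<in>A. 1 + f i)"
  using assms
proof (induction A rule: finite_induct)
  case (insert a A)
  have "0 \<le> f a * sum f A" using insert by (intro mult_nonneg_nonneg sum_nonneg) auto
  then have "1 + sum f (insert a A) \<le> (1 + f a) * (1 + sum f A)"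
    using insert by (simp add: algebra_simps)
  also have "\<dots> \<le> (1 + f a) * (\<Prod>i\<in>A. 1 + f i)" using insert by (intro mult_left_mono) auto
  finally show ?case using insert by simp
qed simp

text \<open>Every finite set of multi-indices lies in a cube, over which the sum factors into
  partial sums of one convergent series.\<close>

lemma summable_on_prod_fun:
  fixes g :: "nat \<Rightarrow> real"
  assumes g: "\<And>t. 0 \<le> g t" "summable g"
  shows "(\<lambda>k::'m::finite \<Rightarrow> nat. \<Prod>i\<in>UNIV. g (k i)) summable_on UNIV"
proof (rule nonneg_bdd_above_summable_on)
  show "0 \<le> (\<Prod>i\<in>UNIV. g (k i))" for k :: "'m \<Rightarrow> nat" using g by (intro prod_nonneg) auto
  show "bdd_above (sum (\<lambda>k::'m \<Rightarrow> nat. \<Prod>i\<in>UNIV. g (k i)) ` {F. F \<subseteq> UNIV \<and> finite F})"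
  proof (rule bdd_aboveI2)
    fix F :: "('m \<Rightarrow> nat) set" assume "F \<in> {F. F \<subseteq> UNIV \<and> finite F}"
    then have fin: "finite F" by simp
    define n where "n = Suc (\<Sum>k\<in>F. sum k UNIV)"
    have "F \<subseteq> PiE UNIV (\<lambda>_. {..<n})"
    proof
      fix k assume "k \<in> F"
      then have "sum k UNIV \<le> (\<Sum>k\<in>F. sum k UNIV)" using fin by (intro member_le_sum) auto
      then have "k i < n" for i using le_sum_UNIV[of k i] by (simp add: n_def)
      then show "k \<in> PiE UNIV (\<lambda>_. {..<n})" by auto
    qed
    then have "(\<Sum>k\<in>F. \<Prod>i\<in>UNIV. g (k i)) \<le> (\<Sum>k\<in>PiE UNIV (\<lambda>_. {..<n}). \<Prod>i\<in>(UNIV::'m set). g (k i))"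
      using g by (intro sum_mono2) (auto intro!: prod_nonneg finite_PiE)
    also have "\<dots> = (\<Prod>i\<in>(UNIV::'m set). \<Sum>t<n. g t)" by (rule prod_sum_PiE[symmetric]) auto
    also have "\<dots> \<le> (\<Prod>i\<in>(UNIV::'m set). suminf g)"
      using g by (intro prod_mono) (auto intro!: sum_nonneg sum_le_suminf)
    finally show "(\<Sum>k\<in>F. \<Prod>i\<in>UNIV. g (k i)) \<le> (\<Prod>i\<in>(UNIV::'m set). suminf g)" .
  qed
qed

text \<open>The common majorant of all exceptional probabilities. As \<open>bigL k\<close> dominates
  each 2 ^ k i, its power with exponent \<open>CARD('m)\<close> dominates their product; hence 1 /
  \<open>bigL k\<close> is at most the product of c ^ k i with c the root of 1 / 2 of that order,
  and the numerator is absorbed by the product of the factors 1 + k i.\<close>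

lemma summable_on_ratio:
  "(\<lambda>k::'m::finite \<Rightarrow> nat. (1 + real (sum k UNIV)) / real (bigL k)) summable_on UNIV"
proof -
  define c :: real where "c = root CARD('m) (1 / 2)"
  have c: "0 < c" "c < 1" "c ^ CARD('m) = 1 / 2" unfolding c_def by auto
  have "summable (\<lambda>t. real (Suc t) * c ^ t)"
    using geometric_deriv_sums[of c] c by (auto simp: sums_iff)
  then have "(\<lambda>k::'m \<Rightarrow> nat. \<Prod>i\<in>UNIV. real (Suc (k i)) * c ^ k i) summable_on UNIV"
    using c by (intro summable_on_prod_fun) auto
  then show ?thesis
  proof (rule summable_on_comparison_test)
    fix k :: "'m \<Rightarrow> nat"
    have "(1 / real (bigL k)) ^ CARD('m) \<le> (\<Prod>i\<in>UNIV. c ^ k i) ^ CARD('m)"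
    proof -
      have "(\<Prod>i\<in>UNIV. (2::real) ^ k i) \<le> (\<Prod>i\<in>(UNIV::'m set). real (bigL k))"
      proof (rule prod_mono, intro conjI)
        fix i
        have "real (2 ^ k i) \<le> real (bigL k)" using power_le_bigL[of k i] by (simp only: of_nat_le_iff)
        then show "2 ^ k i \<le> real (bigL k)" by simp
      qed simp
      then have "1 / real (bigL k) ^ CARD('m) \<le> 1 / (\<Prod>i\<in>UNIV. (2::real) ^ k i)"
        by (intro divide_left_mono) (use bigL_ge_1[of k] in \<open>auto intro!: mult_pos_pos prod_pos\<close>)
      also have "\<dots> = (\<Prod>i\<in>UNIV. (c ^ CARD('m)) ^ k i)" by (simp add: c power_one_over prod_dividef)
      also have "\<dots> = (\<Prod>i\<in>UNIV. c ^ k i) ^ CARD('m)"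
        by (simp add: prod_power_distrib mult.commute flip: power_mult)
      finally show ?thesis by (simp add: power_one_over)
    qed
    then have "1 / real (bigL k) \<le> (\<Prod>i\<in>UNIV. c ^ k i)"
      using c by (subst (asm) power_mono_iff) (auto intro!: prod_nonneg)
    moreover have "1 + real (sum k UNIV) \<le> (\<Prod>i\<in>UNIV. real (Suc (k i)))"
      using one_plus_sum_le_prod[of UNIV "\<lambda>i. real (k i)"] by simp
    ultimately have "(1 + real (sum k UNIV)) * (1 / real (bigL k)) \<le> (\<Prod>i\<in>UNIV. real (Suc (k i))) * (\<Prod>i\<in>UNIV. c ^ k i)"
      by (intro mult_mono) (auto intro!: prod_nonneg)
    then show "(1 + real (sum k UNIV)) / real (bigL k) \<le> (\<Prod>i\<in>UNIV. real (Suc (k i)) * c ^ k i)"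
      by (simp add: prod.distrib)
  qed (simp add: sum_nonneg)
qed

lemma finite_ge_if_summable_on:
  fixes f :: "'k \<Rightarrow> real"
  assumes f: "f summable_on UNIV" "\<And>k. 0 \<le> f k" and e: "0 < e"
  shows "finite {k. e \<le> f k}"
proof (rule ccontr)
  assume inf: "infinite {k. e \<le> f k}"
  obtain n :: nat where n: "infsum f UNIV / e < real n" using reals_Archimedean2 by blast
  obtain F where F: "F \<subseteq> {k. e \<le> f k}" "finite F" "card F = n"
    using infinite_arbitrarily_large[OF inf] by blast
  have "real n * e = (\<Sum>k\<in>F. e)" using F by simp
  also have "\<dots> \<le> sum f F" using F by (intro sum_mono) auto
  also have "\<dots> \<le> infsum f UNIV" using f F by (intro finite_sum_le_infsum) auto
  finally show False using n e by (simp add: field_simps)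
qed

text \<open>Borel-Cantelli along an enumeration of the multi-indices. These carry no natural linear
  order, so the conclusion is finiteness of the exceptional set instead of eventual
  validity.\<close>

lemma (in prob_space) AE_finite_events:
  fixes B :: "('m::finite \<Rightarrow> nat) \<Rightarrow> 'a set"
  assumes B: "\<And>k. B k \<in> events" and f: "f summable_on UNIV" "\<And>k. prob (B k) \<le> f k"
  shows "AE \<omega> in M. finite {k. \<omega> \<in> B k}"
proof -
  have inf: "infinite (UNIV :: ('m \<Rightarrow> nat) set)"
    using finite_fun_UNIVD2 infinite_UNIV_nat by blast
  define h :: "nat \<Rightarrow> ('m \<Rightarrow> nat)" where "h = from_nat_into UNIV"
  have h: "bij_betw h UNIV UNIV" unfolding h_def by (rule bij_betw_from_nat_into[OF _ inf]) auto
  have "(\<lambda>k. prob (B k)) summable_on UNIV"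
    by (rule summable_on_comparison_test[OF f(1)]) (use f in auto)
  then have "(\<lambda>n. prob (B (h n))) summable_on UNIV"
    using summable_on_reindex_bij_betw[OF h, of "\<lambda>k. prob (B k)"] by simp
  then have "summable (\<lambda>n. prob (B (h n)))" by (rule summable_on_imp_summable)
  then have "AE \<omega> in M. eventually (\<lambda>n. \<omega> \<in> space M - B (h n)) sequentially"
    by (intro borel_cantelli_AE1) (auto simp: B less_top[symmetric])
  then show ?thesis
  proof (rule AE_mp, intro AE_I2 impI)
    fix \<omega> assume "eventually (\<lambda>n. \<omega> \<in> space M - B (h n)) sequentially"
    then obtain N where N: "\<And>n. n \<ge> N \<Longrightarrow> \<omega> \<notin> B (h n)" by (auto simp: eventually_sequentially)
    have "{k. \<omega> \<in> B k} \<subseteq> h ` {..<N}"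
    proof
      fix k assume k: "k \<in> {k. \<omega> \<in> B k}"
      obtain n where "k = h n" using h by (metis bij_betw_imp_surj_on rangeE UNIV_I)
      with k N[of n] show "k \<in> h ` {..<N}" by (metis imageI lessThan_iff mem_Collect_eq not_le)
    qed
    then show "finite {k. \<omega> \<in> B k}" by (rule finite_subset) simp
  qed
qed

lemma (in prob_space) variance_sum_indicator:
  fixes c :: "'i \<Rightarrow> real"
  assumes I: "finite I" and A: "\<And>i. i \<in> I \<Longrightarrow> A i \<in> events"
  defines "X \<equiv> \<lambda>\<omega>. \<Sum>i\<in>I. c i * indicator (A i) \<omega>"
  shows "random_variable borel X" "integrable M (\<lambda>\<omega>. (X \<omega>)\<^sup>2)"
    "expectation X = (\<Sum>i\<in>I. c i * prob (A i))"
    "variance X = (\<Sum>i\<in>I. \<Sum>i'\<in>I. c i * c i' * (prob (A i \<inter> A i') - prob (A i) * prob (A i')))"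
proof -
  have int: "integrable M (indicat_real B)" if "B \<in> events" for B
    using that by (simp add: integrable_indicator_iff less_top[symmetric])
  have intX: "integrable M X" unfolding X_def
    by (intro Bochner_Integration.integrable_sum integrable_mult_right int A)
  then show "random_variable borel X" by simp
  have sq: "(X \<omega>)\<^sup>2 = (\<Sum>i\<in>I. \<Sum>i'\<in>I. c i * c i' * indicator (A i \<inter> A i') \<omega>)" for \<omega>
    unfolding X_def power2_eq_square sum_product
    by (intro sum.cong refl) (auto simp: indicator_def)
  show int2: "integrable M (\<lambda>\<omega>. (X \<omega>)\<^sup>2)" unfolding sq
    by (intro Bochner_Integration.integrable_sum integrable_mult_right int sets.Int A)
  show ex: "expectation X = (\<Sum>i\<in>I. c i * prob (A i))" unfolding X_def
    by (subst Bochner_Integration.integral_sum) (auto intro!: integrable_mult_right int A sum.cong simp: A)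
  have "expectation (\<lambda>\<omega>. (X \<omega>)\<^sup>2) = (\<Sum>i\<in>I. \<Sum>i'\<in>I. c i * c i' * prob (A i \<inter> A i'))"
    unfolding sq
  proof (subst Bochner_Integration.integral_sum)
    show "integrable M (\<lambda>\<omega>. \<Sum>i'\<in>I. c i * c i' * indicator (A i \<inter> A i') \<omega>)" if "i \<in> I" for i
      using that by (intro Bochner_Integration.integrable_sum integrable_mult_right int sets.Int A)
    have "expectation (\<lambda>\<omega>. \<Sum>i'\<in>I. c i * c i' * indicator (A i \<inter> A i') \<omega>) = (\<Sum>i'\<in>I. c i * c i' * prob (A i \<inter> A i'))"
      if "i \<in> I" for i
    proof (subst Bochner_Integration.integral_sum)
      show "integrable M (\<lambda>\<omega>. c i * c i' * indicator (A i \<inter> A i') \<omega>)" if "i' \<in> I" for i'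
        using that \<open>i \<in> I\<close> by (intro integrable_mult_right int sets.Int A)
      have "A i \<inter> A i' \<inter> space M = A i \<inter> A i'" if "i' \<in> I" for i'
        using sets.sets_into_space[OF A[OF that]] by auto
      then show "(\<Sum>i'\<in>I. expectation (\<lambda>\<omega>. c i * c i' * indicator (A i \<inter> A i') \<omega>)) = (\<Sum>i'\<in>I. c i * c i' * prob (A i \<inter> A i'))"
        by (intro sum.cong refl) simp
    qed
    then show "(\<Sum>i\<in>I. expectation (\<lambda>\<omega>. \<Sum>i'\<in>I. c i * c i' * indicator (A i \<inter> A i') \<omega>))
        = (\<Sum>i\<in>I. \<Sum>i'\<in>I. c i * c i' * prob (A i \<inter> A i'))"
      by (intro sum.cong refl)
  qed
  moreover have "(expectation X)\<^sup>2 = (\<Sum>i\<in>I. \<Sum>i'\<in>I. c i * c i' * (prob (A i) * prob (A i')))"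
    by (simp add: ex power2_eq_square sum_product mult_ac)
  ultimately show "variance X = (\<Sum>i\<in>I. \<Sum>i'\<in>I. c i * c i' * (prob (A i \<inter> A i') - prob (A i) * prob (A i')))"
    using variance_eq[OF intX int2] by (simp only: sum_subtractf right_diff_distrib)
qed

text \<open>When the product is expanded, each of the 2 ^ \<open>card S\<close> - 1 nonempty subsets
  contributes at most the full product of the z i divided by s: missing factors z i and further
  divisions by s only help.\<close>

lemma prod_one_plus_le:
  fixes e z :: "'i \<Rightarrow> real"
  assumes "finite S" and e: "\<And>i. i \<in> S \<Longrightarrow> 0 \<le> e i \<and> e i \<le> z i / s" and z: "\<And>i. i \<in> S \<Longrightarrow> 1 \<le> z i" and s: "1 \<le> s"
  shows "(\<Prod>i\<in>S. 1 + e i) \<le> 1 + (2 ^ card S - 1) * ((\<Prod>i\<in>S. z i) / s)"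
  using assms(1) e z
proof (induction S rule: finite_induct)
  case (insert a S)
  let ?c = "2 ^ card S - 1 :: real" and ?Z = "\<Prod>i\<in>S. z i"
  have c: "0 \<le> ?c" by simp
  have Z: "1 \<le> ?Z" using insert by (intro prod_ge_1) auto
  have za: "1 \<le> z a" "0 \<le> e a" "e a \<le> z a / s" using insert by auto
  have "(\<Prod>i\<in>insert a S. 1 + e i) \<le> (1 + z a / s) * (1 + ?c * (?Z / s))"
  proof -
    have "(1 + e a) * (\<Prod>i\<in>S. 1 + e i) \<le> (1 + z a / s) * (1 + ?c * (?Z / s))"
    proof (rule mult_mono)
      show "(\<Prod>i\<in>S. 1 + e i) \<le> 1 + ?c * (?Z / s)" using insert by auto
      show "0 \<le> (\<Prod>i\<in>S. 1 + e i)" using insert by (intro prod_nonneg) auto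
      show "0 \<le> 1 + z a / s" using za by linarith
    qed (use za in auto)
    then show ?thesis using insert by simp
  qed
  also have "\<dots> = 1 + z a / s * 1 + ?c * (1 * ?Z / s) + ?c * (z a * ?Z / s * (1 / s))"
    using s by (simp add: field_simps)
  also have "\<dots> \<le> 1 + z a / s * ?Z + ?c * (z a * ?Z / s) + ?c * (z a * ?Z / s * 1)"
    using za Z c s by (intro add_mono mult_left_mono divide_right_mono mult_right_mono) auto
  also have "\<dots> = 1 + (2 ^ card (insert a S) - 1) * ((\<Prod>i\<in>insert a S. z i) / s)"
    using insert s by (simp add: field_simps)
  finally show ?case .
qed simp

text \<open>One nonzero entry gains the factor 1 / a; the others, which may vanish, at worst gain
  nothing.\<close>

lemma weight_scale_le:
  assumes "u \<noteq> (\<lambda>_. 0)" "0 < a"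
  shows "weight (\<lambda>i. a * u i) \<le> weight u / real a"
proof -
  obtain i0 where i0: "0 < u i0" using assms by auto
  have "weight (\<lambda>i. a * u i) = 1 / max 1 (real (a * u i0)) * (\<Prod>i\<in>UNIV - {i0}. 1 / max 1 (real (a * u i)))"
    unfolding weight_def by (rule prod.remove) auto
  also have "\<dots> \<le> (1 / max 1 (real (u i0)) / real a) * (\<Prod>i\<in>UNIV - {i0}. 1 / max 1 (real (u i)))"
  proof (intro mult_mono prod_mono conjI divide_left_mono)
    have "1 \<le> real a" "1 \<le> real (u i0)" using i0 assms by auto
    moreover have "1 \<le> real (a * u i0)" using i0 assms by (metis Suc_leI nat_0_less_mult_iff of_nat_1 of_nat_mono One_nat_def)
    ultimately show "1 / max 1 (real (a * u i0)) \<le> 1 / max 1 (real (u i0)) / real a"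
      by (simp add: max_def mult.commute)
    fix i
    have "u i \<le> a * u i" using assms by simp
    then show "max 1 (real (u i)) \<le> max 1 (real (a * u i))" by (metis max.mono of_nat_mono order_refl)
  qed (auto intro!: prod_nonneg mult_pos_pos)
  also have "\<dots> = weight u / real a"
    unfolding weight_def by (subst (2) prod.remove[of _ i0]) auto
  finally show ?thesis .
qed

text \<open>Finitely many exceptions are absorbed by the constants because both functions are
  positive.\<close>

lemma two_sided_bounds_extend:
  fixes f g :: "'k \<Rightarrow> real"
  assumes B: "finite B" and pos: "\<And>k. 0 < f k" "\<And>k. 0 < g k"
    and c: "0 < c" "0 < C" "\<And>k. k \<notin> B \<Longrightarrow> c * g k \<le> f k \<and> f k \<le> C * g k"
  shows "\<exists>c>0. \<exists>C>0. \<forall>k. c * g k \<le> f k \<and> f k \<le> C * g k"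
proof -
  let ?c = "Min (insert c ((\<lambda>k. f k / g k) ` B))" and ?C = "Max (insert C ((\<lambda>k. f k / g k) ` B))"
  have "0 < ?c" using B pos c by (subst Min_gr_iff) auto
  moreover have "0 < ?C" using B pos c by (subst Max_gr_iff) auto
  moreover have "?c * g k \<le> f k \<and> f k \<le> ?C * g k" for k
  proof (cases "k \<in> B")
    case True
    have "?c \<le> f k / g k" "f k / g k \<le> ?C" using B True by auto
    then show ?thesis using pos(2)[of k] by (simp only: pos_le_divide_eq pos_divide_le_eq)
  next
    case False
    have "?c \<le> c" "C \<le> ?C" using B by auto
    then have "?c * g k \<le> c * g k" "C * g k \<le> ?C * g k"
      using pos(2)[of k] by (auto intro: mult_right_mono)
    with c(3)[OF False] show ?thesis by linarith
  qed
  ultimately show ?thesis by blast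
qed

subsection \<open>Sums of reciprocals of random phases\<close>

text \<open>A common framework for both sums: the phase x q i is the i-th of r linear forms evaluated at
  an integer vector q with m entries. The sum S is the case m = n, r = 1 and S* is the case m = 1,
  r = n. Only the second-order statistics of the phases enter.\<close>

locale lattice_phases = prob_space M for M :: "'a measure" +
  fixes x :: "('m::finite \<Rightarrow> nat) \<Rightarrow> 'r::finite \<Rightarrow> 'a \<Rightarrow> real"
    and hit :: "('m \<Rightarrow> nat) \<Rightarrow> ('r \<Rightarrow> nat) \<Rightarrow> 'a set"
  defines "hit \<equiv> \<lambda>q j. {\<omega> \<in> space M. \<forall>i. deep (j i) (x q i \<omega>)}"
  assumes x_measurable [measurable]: "\<And>q i. x q i \<in> borel_measurable M"
    and prob_hit: "\<And>q j. q \<noteq> (\<lambda>_. 0) \<Longrightarrow> prob (hit q j) = (1 / 2) ^ sum j UNIV"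
    and prob_hit_parallel: "\<And>u a b j l. u \<noteq> (\<lambda>_. 0) \<Longrightarrow> 0 < a \<Longrightarrow> 0 < b \<Longrightarrow> coprime a b \<Longrightarrow>
      prob (hit (\<lambda>i. a * u i) j \<inter> hit (\<lambda>i. b * u i) l)
        \<le> (\<Prod>i\<in>UNIV. (1 / 2) ^ (j i + l i) + min ((1 / 2) ^ j i / real a) ((1 / 2) ^ l i / real b))"
    and prob_hit_independent: "\<And>q q' j l. q \<noteq> (\<lambda>_. 0) \<Longrightarrow> q' \<noteq> (\<lambda>_. 0) \<Longrightarrow>
      \<not> (\<exists>u a b. 0 < a \<and> 0 < b \<and> coprime a b \<and> q = (\<lambda>i. a * u i) \<and> q' = (\<lambda>i. b * u i)) \<Longrightarrow>
      prob (hit q j \<inter> hit q' l) \<le> (1 / 2) ^ sum j UNIV * (1 / 2) ^ sum l UNIV"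
begin

lemma sets_hit [measurable]: "hit q j \<in> events"
proof -
  have [measurable]: "Measurable.pred borel (deep n)" for n
    unfolding deep_def[abs_def] by measurable
  show ?thesis unfolding hit_def by measurable
qed

definition recip_sum :: "('m \<Rightarrow> nat) \<Rightarrow> 'a \<Rightarrow> real" where
  "recip_sum k \<omega> = (\<Sum>q\<in>qbox k. weight q * (\<Prod>i\<in>UNIV. 1 / dnint (x q i \<omega>)))"

definition level_count :: "('m \<Rightarrow> nat) \<Rightarrow> (('m \<Rightarrow> nat) \<Rightarrow> ('r \<Rightarrow> nat) set) \<Rightarrow> 'a \<Rightarrow> real" where
  "level_count k D \<omega> = (\<Sum>q\<in>qbox k. \<Sum>j\<in>D q. weight q * 2 ^ sum j UNIV * indicator (hit q j) \<omega>)"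

definition growth :: "('m \<Rightarrow> nat) \<Rightarrow> real" where
  "growth k = real (bigL k) ^ CARD('r) * bigP k"

text \<open>Levels below the first cutoff have small enough variance for Chebyshev's inequality; the
  levels between the cutoffs are too few to matter, so that Markov's inequality suffices for them;
  levels beyond the second cutoff occur for finitely many boxes only.\<close>

definition bulk :: "('m \<Rightarrow> nat) \<Rightarrow> ('m \<Rightarrow> nat) \<Rightarrow> ('r \<Rightarrow> nat) set" where
  "bulk k q = levels (bits q - 2 * sum k UNIV)"

definition cutoff :: "('m \<Rightarrow> nat) \<Rightarrow> ('m \<Rightarrow> nat) \<Rightarrow> nat" where
  "cutoff k q = bits q + (CARD('r) + 2) * sum k UNIV"

definition edge :: "('m \<Rightarrow> nat) \<Rightarrow> ('m \<Rightarrow> nat) \<Rightarrow> ('r \<Rightarrow> nat) set" where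
  "edge k q = levels (cutoff k q) - bulk k q"

lemma growth_pos: "0 < growth k"
  unfolding growth_def using bigL_ge_1[of k] bigP_ge_1[of k] by simp

lemma finite_bulk [simp]: "finite (bulk k q)" and finite_edge [simp]: "finite (edge k q)"
  by (auto simp: bulk_def edge_def)

lemma qbox_nonzero: "q \<in> qbox k \<Longrightarrow> q \<noteq> (\<lambda>_. 0)"
  by (simp add: qbox_def)

lemma level_count_eq_sum:
  assumes "\<And>q. finite (D q)"
  shows "level_count k D = (\<lambda>\<omega>. \<Sum>p\<in>Sigma (qbox k) D. (weight (fst p) * 2 ^ sum (snd p) UNIV) * indicator (hit (fst p) (snd p)) \<omega>)"
  unfolding level_count_def using assms by (subst sum.Sigma) (auto simp: case_prod_beta)

text \<open>The factor 2 ^ \<open>sum j UNIV\<close> cancels the probability of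
  \<open>hit q j\<close>, so the expectation merely counts levels.\<close>

lemma expectation_level_count:
  assumes D: "\<And>q. finite (D q)"
  shows "expectation (level_count k D) = (\<Sum>q\<in>qbox k. weight q * real (card (D q)))"
proof -
  have "expectation (level_count k D) = (\<Sum>p\<in>Sigma (qbox k) D. weight (fst p) * 2 ^ sum (snd p) UNIV * prob (hit (fst p) (snd p)))"
    unfolding level_count_eq_sum[OF D] by (rule variance_sum_indicator(3)) (auto simp: D)
  also have "\<dots> = (\<Sum>p\<in>Sigma (qbox k) D. weight (fst p))"
    by (intro sum.cong refl) (auto simp: prob_hit qbox_nonzero power_one_over)
  also have "\<dots> = (\<Sum>q\<in>qbox k. \<Sum>j\<in>D q. weight q)"
    using D by (subst sum.Sigma) (auto simp: case_prod_beta)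
  finally show ?thesis by (simp add: mult.commute)
qed

section \<open>Second moment of the bulk\<close>

definition cov :: "('m \<Rightarrow> nat) \<Rightarrow> ('m \<Rightarrow> nat) \<Rightarrow> ('m \<Rightarrow> nat) \<Rightarrow> real" where
  "cov k q q' = (\<Sum>j\<in>bulk k q. \<Sum>l\<in>bulk k q'. (weight q * 2 ^ sum j UNIV) * (weight q' * 2 ^ sum l UNIV)
      * (prob (hit q j \<inter> hit q' l) - prob (hit q j) * prob (hit q' l)))"

text \<open>Covariances of non-parallel vectors are nonpositive, so only pairs of multiples of a common vector
  contribute.\<close>

lemma variance_bulk: "variance (level_count k (bulk k)) = (\<Sum>q\<in>qbox k. \<Sum>q'\<in>qbox k. cov k q q')"
proof -
  let ?c = "\<lambda>q j. weight q * 2 ^ sum j UNIV"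
  let ?f = "\<lambda>q j q' l. ?c q j * ?c q' l * (prob (hit q j \<inter> hit q' l) - prob (hit q j) * prob (hit q' l))"
  have "variance (level_count k (bulk k)) = (\<Sum>p\<in>Sigma (qbox k) (bulk k). \<Sum>p'\<in>Sigma (qbox k) (bulk k).
      ?f (fst p) (snd p) (fst p') (snd p'))"
    unfolding level_count_eq_sum[OF finite_bulk] by (rule variance_sum_indicator(4)) auto
  also have "\<dots> = (\<Sum>p\<in>Sigma (qbox k) (bulk k). \<Sum>q'\<in>qbox k. \<Sum>l\<in>bulk k q'. ?f (fst p) (snd p) q' l)"
    by (subst sum.Sigma) (auto simp: case_prod_beta)
  also have "\<dots> = (\<Sum>q\<in>qbox k. \<Sum>j\<in>bulk k q. \<Sum>q'\<in>qbox k. \<Sum>l\<in>bulk k q'. ?f q j q' l)"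
    by (subst (2) sum.Sigma) (auto simp: case_prod_beta)
  also have "\<dots> = (\<Sum>q\<in>qbox k. \<Sum>q'\<in>qbox k. \<Sum>j\<in>bulk k q. \<Sum>l\<in>bulk k q'. ?f q j q' l)"
    by (intro sum.cong refl sum.swap)
  finally show ?thesis by (simp only: cov_def)
qed

lemma cov_nonparallel:
  assumes q: "q \<in> qbox k" "q' \<in> qbox k"
    and np: "\<not> (\<exists>u a b. 0 < a \<and> 0 < b \<and> coprime a b \<and> q = (\<lambda>i. a * u i) \<and> q' = (\<lambda>i. b * u i))"
  shows "cov k q q' \<le> 0"
  unfolding cov_def
proof (intro sum_nonpos mult_nonneg_nonpos)
  fix j l
  show "prob (hit q j \<inter> hit q' l) - prob (hit q j) * prob (hit q' l) \<le> 0"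
    using prob_hit_independent[OF _ _ np, of j l] q by (simp add: prob_hit qbox_nonzero)
qed (auto intro: less_imp_le)

lemma card_bulk_le:
  assumes "q \<in> qbox k"
  shows "real (card (bulk k q)) \<le> real (bigL k) ^ CARD('r)"
proof -
  have "card (bulk k q) \<le> (bits q - 2 * sum k UNIV) ^ CARD('r)" unfolding bulk_def by (rule card_levels_le)
  also have "\<dots> \<le> bigL k ^ CARD('r)" using bits_le_bigL[OF assms] by (intro power_mono) auto
  finally have "real (card (bulk k q)) \<le> real (bigL k ^ CARD('r))" by (simp only: of_nat_le_iff)
  then show ?thesis by simp
qed

text \<open>Staying 2 * \<open>sum k UNIV\<close> below the critical depth buys two factors
  \<open>bigP k\<close>. With these the relative variance is bounded by L^2 / P^3 up to constants;
  one factor would only give L^2 / P^2, which does not decay when a single k i dominates.\<close>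

lemma bulk_level_bound:
  assumes "j \<in> bulk k q"
  shows "2 ^ sum j UNIV * weight q \<le> 1 / (bigP k)\<^sup>2"
proof -
  have "sum j UNIV + 2 * sum k UNIV \<le> bits q" using assms by (simp add: bulk_def levels_def)
  then have "(2::real) ^ (sum j UNIV + 2 * sum k UNIV) * weight q \<le> 2 ^ bits q * weight q"
    by (intro mult_right_mono power_increasing) (auto intro: less_imp_le)
  also have "\<dots> \<le> 1" by (rule two_power_bits_le)
  finally have "2 ^ sum j UNIV * (bigP k)\<^sup>2 * weight q \<le> 1"
    by (simp only: bigP_def power_add power_even_eq)
  then show ?thesis using bigP_ge_1[of k] by (simp add: field_simps)
qed

text \<open>Normalised by 2 ^ \<open>sum j UNIV\<close> and 2 ^ \<open>sum l UNIV\<close>, the joint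
  probability is at most a product of factors 1 + e i, whose leading 1 is cancelled by the product
  of the single probabilities. The remainder is weighed against \<open>bulk_level_bound\<close> and
  \<open>weight_scale_le\<close>.\<close>

lemma cov_parallel:
  assumes u: "u \<noteq> (\<lambda>_. 0)" and ab: "0 < a" "0 < b" "coprime a b"
    and q: "(\<lambda>i. a * u i) \<in> qbox k" "(\<lambda>i. b * u i) \<in> qbox k"
  shows "cov k (\<lambda>i. a * u i) (\<lambda>i. b * u i)
    \<le> real (bigL k) ^ (2 * CARD('r)) * (2 ^ CARD('r) / (bigP k)\<^sup>2 * (weight u / (real a * real b)))"
proof -
  let ?q = "\<lambda>i. a * u i" and ?q' = "\<lambda>i. b * u i"
  let ?B = "2 ^ CARD('r) / (bigP k)\<^sup>2 * (weight u / (real a * real b))"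
  have P: "0 < bigP k" using bigP_ge_1[of k] by simp
  have bnd: "(weight ?q * 2 ^ sum j UNIV) * (weight ?q' * 2 ^ sum l UNIV)
      * (prob (hit ?q j \<inter> hit ?q' l) - prob (hit ?q j) * prob (hit ?q' l)) \<le> ?B"
    if j: "j \<in> bulk k ?q" and l: "l \<in> bulk k ?q'" for j l
  proof -
    \<comment> \<open>The i-th factor of \<open>prob_hit_parallel\<close>, multiplied by 2 ^ (j i +
      l i), is 1 + e i. The minimum is then replaced by the geometric mean z i / s of its two
      entries, which treats both vectors alike.\<close>
    define e where "e i = min (2 ^ l i / real a) (2 ^ j i / real b)" for i
    define z :: "'r \<Rightarrow> real" where "z i = sqrt (2 ^ l i * 2 ^ j i)" for i
    define s where "s = sqrt (real a * real b)"
    have s1: "1 \<le> s" using ab by (simp add: s_def) (metis One_nat_def Suc_leI nat_0_less_mult_iff of_nat_1 of_nat_le_iff of_nat_mult)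
    have z1: "1 \<le> z i" for i
      using mult_mono[of 1 "2 ^ l i" 1 "2 ^ j i :: real"] by (simp add: z_def)
    have ez: "0 \<le> e i \<and> e i \<le> z i / s" for i
    proof
      show "0 \<le> e i" by (simp add: e_def)
      have "(e i)\<^sup>2 \<le> (2 ^ l i / real a) * (2 ^ j i / real b)"
        unfolding power2_eq_square by (intro mult_mono) (auto simp: e_def)
      also have "\<dots> = (z i / s)\<^sup>2" by (simp add: z_def s_def power_divide)
      finally show "e i \<le> z i / s" using z1[of i] s1 by (auto intro: power2_le_imp_le)
    qed
    have "2 ^ sum j UNIV * 2 ^ sum l UNIV * prob (hit ?q j \<inter> hit ?q' l)
        \<le> 2 ^ sum j UNIV * 2 ^ sum l UNIV *
          (\<Prod>i\<in>UNIV. (1 / 2) ^ (j i + l i) + min ((1 / 2) ^ j i / real a) ((1 / 2) ^ l i / real b))"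
      by (intro mult_left_mono prob_hit_parallel u ab) auto
    also have "\<dots> = (\<Prod>i\<in>UNIV. (2 ^ j i * 2 ^ l i) * ((1 / 2) ^ (j i + l i) + min ((1 / 2) ^ j i / real a) ((1 / 2) ^ l i / real b)))"
      by (simp add: prod.distrib power_sum)
    also have "\<dots> = (\<Prod>i\<in>UNIV. 1 + e i)"
    proof (rule prod.cong[OF refl])
      fix i
      have "(2 ^ j i * 2 ^ l i) * min ((1 / 2) ^ j i / real a) ((1 / 2) ^ l i / real b) = e i"
        unfolding e_def by (subst min_mult_distrib_left) (simp add: power_one_over)
      moreover have "(2 ^ j i * 2 ^ l i) * (1 / 2) ^ (j i + l i) = (1::real)" by (simp add: power_add power_one_over)
      ultimately show "(2 ^ j i * 2 ^ l i) * ((1 / 2) ^ (j i + l i) + min ((1 / 2) ^ j i / real a) ((1 / 2) ^ l i / real b)) = 1 + e i"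
        by (simp only: distrib_left)
    qed
    also have "\<dots> \<le> 1 + (2 ^ CARD('r) - 1) * ((\<Prod>i\<in>UNIV. z i) / s)"
      by (rule prod_one_plus_le) (use ez z1 s1 in auto)
    also have "(2 ^ CARD('r) - 1) * ((\<Prod>i\<in>UNIV. z i) / s) \<le> 2 ^ CARD('r) * ((\<Prod>i\<in>UNIV. z i) / s)"
      using z1 s1 by (intro mult_right_mono divide_nonneg_pos prod_nonneg) (auto intro: order_trans[OF zero_le_one])
    also have "(\<Prod>i\<in>UNIV. z i) = sqrt (2 ^ sum l UNIV * 2 ^ sum j UNIV)"
    proof -
      have "(\<Prod>i\<in>A. sqrt (f i)) = sqrt (\<Prod>i\<in>A. f i)" for A and f :: "'r \<Rightarrow> real"
        by (induction A rule: infinite_finite_induct) (auto simp: real_sqrt_mult)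
      then show ?thesis by (simp only: z_def power_sum prod.distrib)
    qed
    finally have main: "2 ^ sum j UNIV * 2 ^ sum l UNIV * prob (hit ?q j \<inter> hit ?q' l) - 1
        \<le> 2 ^ CARD('r) * (sqrt (2 ^ sum l UNIV * 2 ^ sum j UNIV) / s)" by simp
    have nz: "?q \<noteq> (\<lambda>_. 0)" "?q' \<noteq> (\<lambda>_. 0)" using q by (auto dest: qbox_nonzero)
    have "(weight ?q * 2 ^ sum j UNIV) * (weight ?q' * 2 ^ sum l UNIV)
      * (prob (hit ?q j \<inter> hit ?q' l) - prob (hit ?q j) * prob (hit ?q' l))
      = weight ?q * weight ?q' * (2 ^ sum j UNIV * 2 ^ sum l UNIV * prob (hit ?q j \<inter> hit ?q' l) - 1)"
    proof -
      have "(w * A) * (w' * B) * (p - 1 / A * (1 / B)) = w * w' * (A * B * p - 1)"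
        if "A \<noteq> 0" "B \<noteq> 0" for w w' A B p :: real
        using that by (simp add: field_simps)
      then show ?thesis unfolding prob_hit[OF nz(1)] prob_hit[OF nz(2)] power_one_over by simp
    qed
    also have "\<dots> \<le> weight ?q * weight ?q' * (2 ^ CARD('r) * (sqrt (2 ^ sum l UNIV * 2 ^ sum j UNIV) / s))"
      by (intro mult_left_mono main) (auto intro: less_imp_le)
    also have "\<dots> = 2 ^ CARD('r) * (weight ?q * weight ?q' * sqrt (2 ^ sum l UNIV * 2 ^ sum j UNIV) / s)"
      by simp
    also have "\<dots> \<le> 2 ^ CARD('r) * (1 / (bigP k)\<^sup>2 * (weight u / (real a * real b)))"
    proof (rule mult_left_mono, rule power2_le_imp_le)
      \<comment> \<open>Squaring removes the root and regroups the factors: each weight occurs once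
        with its power of 2, bounded on the bulk, and once alone, where scaling gains 1 / a or 1 /
        b.\<close>
      have "(weight ?q * weight ?q' * sqrt (2 ^ sum l UNIV * 2 ^ sum j UNIV) / s)\<^sup>2
          = (2 ^ sum j UNIV * weight ?q) * (2 ^ sum l UNIV * weight ?q') * (weight ?q * weight ?q') / (real a * real b)"
        using ab by (simp add: s_def power_divide power_mult_distrib power2_eq_square)
      also have "\<dots> \<le> (1 / (bigP k)\<^sup>2) * (1 / (bigP k)\<^sup>2) * ((weight u / real a) * (weight u / real b)) / (real a * real b)"
        using u ab by (intro divide_right_mono mult_mono bulk_level_bound j l weight_scale_le) (auto intro: less_imp_le)
      also have "\<dots> = (1 / (bigP k)\<^sup>2 * (weight u / (real a * real b)))\<^sup>2"
        by (simp add: power2_eq_square)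
      finally show "(weight ?q * weight ?q' * sqrt (2 ^ sum l UNIV * 2 ^ sum j UNIV) / s)\<^sup>2
          \<le> (1 / (bigP k)\<^sup>2 * (weight u / (real a * real b)))\<^sup>2" .
    qed (auto intro: less_imp_le)
    finally show ?thesis by simp
  qed
  have B0: "0 \<le> ?B" using P by (auto intro: less_imp_le)
  have "cov k ?q ?q' \<le> (\<Sum>j\<in>bulk k ?q. \<Sum>l\<in>bulk k ?q'. ?B)"
    unfolding cov_def by (intro sum_mono bnd)
  also have "\<dots> = real (card (bulk k ?q)) * real (card (bulk k ?q')) * ?B" by simp
  also have "\<dots> \<le> (real (bigL k) ^ CARD('r) * real (bigL k) ^ CARD('r)) * ?B"
    using B0 by (intro mult_right_mono mult_mono card_bulk_le q) auto
  finally show ?thesis by (simp add: mult_2 power_add)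
qed

text \<open>Parallel pairs are parametrised by a common vector u and two multipliers. The bound for
  their covariances then factors into the total weight of the box and two harmonic sums, each at
  most \<open>bigL k\<close>.\<close>

lemma variance_bulk_le:
  "variance (level_count k (bulk k)) \<le> 2 ^ (CARD('r) + CARD('m)) * real (bigL k) ^ (2 * CARD('r) + 2) / bigP k"
proof -
  let ?par = "\<lambda>q q'. \<exists>u a b. 0 < a \<and> 0 < b \<and> coprime a b \<and> q = (\<lambda>i. a * u i) \<and> q' = (\<lambda>i. b * u i)"
  \<comment> \<open>Passing to positive parts discards the nonparallel pairs and makes it harmless
    to count a pair several times.\<close>
  let ?g = "\<lambda>p. max 0 (cov k (fst p) (snd p))"
  let ?C = "real (bigL k) ^ (2 * CARD('r)) * (2 ^ CARD('r) / (bigP k)\<^sup>2)"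
  let ?A = "{1..<2 ^ bigL k :: nat}"
  define T where "T = {(u, a, b). u \<in> qbox k \<and> a \<in> ?A \<and> b \<in> ?A \<and> coprime a b
      \<and> (\<lambda>i. a * u i) \<in> qbox k \<and> (\<lambda>i. b * u i) \<in> qbox k}"
  define h :: "('m \<Rightarrow> nat) \<times> nat \<times> nat \<Rightarrow> ('m \<Rightarrow> nat) \<times> ('m \<Rightarrow> nat)"
    where "h = (\<lambda>(u, a, b). ((\<lambda>i. a * u i), (\<lambda>i. b * u i)))"
  have P: "0 < bigP k" using bigP_ge_1[of k] by simp
  have Tsub: "T \<subseteq> qbox k \<times> ?A \<times> ?A" by (auto simp: T_def)
  then have finT: "finite T" by (rule finite_subset) simp
  \<comment> \<open>A box is closed under division by a multiplier, and some nonzero entry of u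
    bounds the multiplier by a side length, hence by 2 ^ \<open>bigL k\<close>.\<close>
  have scale: "u \<in> qbox k \<and> a \<in> ?A" if "(\<lambda>i. a * u i) \<in> qbox k" "0 < a" for u :: "'m \<Rightarrow> nat" and a
  proof
    have lt: "a * u i < 2 ^ 2 ^ k i" for i using that by (auto simp: qbox_def)
    have le: "u i \<le> a * u i" for i using that by simp
    have nz: "u \<noteq> (\<lambda>_. 0)" using qbox_nonzero[OF that(1)] by auto
    then show "u \<in> qbox k" using le_less_trans[OF le lt] by (auto simp: qbox_def)
    obtain i where "0 < u i" using nz by auto
    then have "a \<le> a * u i" by simp
    also have "\<dots> < 2 ^ 2 ^ k i" by (rule lt)
    also have "\<dots> \<le> 2 ^ bigL k" by (intro power_increasing power_le_bigL) simp
    finally show "a \<in> ?A" using that by simp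
  qed
  have par_in: "(q, q') \<in> h ` T" if q: "q \<in> qbox k" "q' \<in> qbox k" and par: "?par q q'" for q q'
  proof -
    obtain u a b where "0 < a" "0 < b" "coprime a b" "q = (\<lambda>i. a * u i)" "q' = (\<lambda>i. b * u i)" using par by blast
    then have "(u, a, b) \<in> T" "(q, q') = h (u, a, b)"
      using q scale[of a u] scale[of b u] by (auto simp: T_def h_def)
    then show ?thesis by blast
  qed
  have "variance (level_count k (bulk k)) = (\<Sum>p\<in>qbox k \<times> qbox k. cov k (fst p) (snd p))"
    unfolding variance_bulk by (subst sum.cartesian_product) (simp add: case_prod_beta)
  also have "\<dots> \<le> (\<Sum>p\<in>qbox k \<times> qbox k. ?g p)" by (intro sum_mono) simp
  also have "\<dots> = (\<Sum>p\<in>(qbox k \<times> qbox k) \<inter> h ` T. ?g p)"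
  proof (rule sum.mono_neutral_right)
    show "\<forall>p\<in>qbox k \<times> qbox k - (qbox k \<times> qbox k) \<inter> h ` T. ?g p = 0"
    proof
      fix p assume "p \<in> qbox k \<times> qbox k - (qbox k \<times> qbox k) \<inter> h ` T"
      then have p: "fst p \<in> qbox k" "snd p \<in> qbox k" and "(fst p, snd p) \<notin> h ` T" by auto
      then have "\<not> ?par (fst p) (snd p)" using par_in[OF p] by (rule_tac notI) (erule notE)
      from cov_nonparallel[OF p this] show "?g p = 0" by simp
    qed
  qed auto
  also have "\<dots> \<le> (\<Sum>p\<in>h ` T. ?g p)" by (intro sum_mono2) (auto simp: finT)
  also have "\<dots> \<le> (\<Sum>t\<in>T. ?g (h t))" using sum_image_le[OF finT, of ?g h] by simp
  also have "\<dots> \<le> (\<Sum>t\<in>T. ?C * (weight (fst t) * (1 / real (fst (snd t)) * (1 / real (snd (snd t))))))"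
  proof (rule sum_mono)
    fix t assume "t \<in> T"
    then obtain u a b where t: "t = (u, a, b)" "u \<in> qbox k" "0 < a" "0 < b" "coprime a b"
      "(\<lambda>i. a * u i) \<in> qbox k" "(\<lambda>i. b * u i) \<in> qbox k" by (auto simp: T_def)
    have "cov k (\<lambda>i. a * u i) (\<lambda>i. b * u i) \<le> ?C * (weight u * (1 / real a * (1 / real b)))"
      using cov_parallel[OF qbox_nonzero[OF t(2)] t(3-7)] by (simp add: mult.assoc)
    moreover have "0 \<le> ?C * (weight u * (1 / real a * (1 / real b)))" using P by (auto intro: less_imp_le)
    ultimately show "?g (h t) \<le> ?C * (weight (fst t) * (1 / real (fst (snd t)) * (1 / real (snd (snd t)))))"
      by (simp add: t h_def)
  qed
  also have "\<dots> \<le> (\<Sum>t\<in>qbox k \<times> ?A \<times> ?A. ?C * (weight (fst t) * (1 / real (fst (snd t)) * (1 / real (snd (snd t))))))"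
    using P by (intro sum_mono2[OF _ Tsub]) (auto intro!: mult_nonneg_nonneg intro: less_imp_le)
  also have "\<dots> = (\<Sum>u\<in>qbox k. \<Sum>a\<in>?A. \<Sum>b\<in>?A. ?C * (weight u * (1 / real a * (1 / real b))))"
    by (simp add: sum.cartesian_product case_prod_beta)
  also have "\<dots> = ?C * ((\<Sum>u\<in>qbox k. weight u) * ((\<Sum>a\<in>?A. 1 / real a) * (\<Sum>b\<in>?A. 1 / real b)))"
    by (simp only: sum_distrib_left[symmetric] sum_distrib_right[symmetric])
  also have "\<dots> \<le> ?C * ((2 ^ CARD('m) * bigP k) * (real (bigL k) * real (bigL k)))"
    using P by (intro mult_left_mono mult_mono sum_weight_le harmonic_block_le)
      (auto intro!: mult_nonneg_nonneg sum_nonneg intro: less_imp_le)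
  also have "\<dots> = 2 ^ (CARD('r) + CARD('m)) * real (bigL k) ^ (2 * CARD('r) + 2) / bigP k"
    using P by (simp add: power_add power2_eq_square field_simps)
  finally show ?thesis .
qed

section \<open>First moment of the bulk\<close>

definition mean_const :: real where
  "mean_const = (1 / (8 * real CARD('r))) ^ CARD('r) * (1 / 4) ^ CARD('m)"

text \<open>Vectors whose entries all lie in the upper half of their range on the logarithmic scale
  carry at least the proportion (1 / 4) ^ \<open>CARD('m)\<close> of \<open>bigP k\<close>, and
  their critical depth is about half of \<open>bigL k\<close>. The hypothesis makes the reduction by
  2 * \<open>sum k UNIV\<close> and all rounding losses affordable; it fails for finitely many boxes
  only.\<close>

lemma expectation_bulk_ge:
  assumes k: "2 * CARD('m) + 8 * sum k UNIV + 8 * CARD('r) \<le> bigL k"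
  shows "mean_const * growth k \<le> expectation (level_count k (bulk k))"
proof -
  \<comment> \<open>The lower end is the square root of the side length, up to rounding when k i =
    0.\<close>
  let ?D = "PiE (UNIV::'m set) (\<lambda>i. {2 ^ (2 ^ k i div 2)..<2 ^ 2 ^ k i :: nat})"
  let ?c = "(real (bigL k) / (8 * real CARD('r))) ^ CARD('r)"
  have pos: "0 < q i" if "q \<in> ?D" for q i
  proof -
    have "2 ^ (2 ^ k i div 2) \<le> q i" using that by auto
    then show ?thesis by (metis less_le_trans zero_less_numeral zero_less_power)
  qed
  have sub: "?D \<subseteq> qbox k"
  proof
    fix q assume q: "q \<in> ?D"
    then have "q i \<noteq> 0" for i using pos by (metis less_irrefl)
    then have "q \<noteq> (\<lambda>_. 0)" by auto
    then show "q \<in> qbox k" using q by (auto simp: qbox_def)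
  qed
  have cnt: "?c \<le> real (card (bulk k q))" if q: "q \<in> ?D" for q
  proof -
    have "2 ^ k i div 2 \<le> floor_log (q i)" for i
    proof -
      have "2 ^ (2 ^ k i div 2) \<le> q i" using q by auto
      then have "floor_log (2 ^ (2 ^ k i div 2)) \<le> floor_log (q i)" by (rule floor_log_le_iff)
      then show ?thesis by simp
    qed
    moreover have "n \<le> 2 * m + 1" if "n div 2 \<le> m" for n m :: nat using that by linarith
    ultimately have "2 ^ k i \<le> 2 * floor_log (q i) + 1" for i by blast
    then have "(\<Sum>i\<in>UNIV. 2 ^ k i) \<le> (\<Sum>i\<in>UNIV. 2 * floor_log (q i) + 1)" by (intro sum_mono)
    also have "\<dots> = 2 * bits q + CARD('m)" unfolding bits_def sum.distrib sum_distrib_left by simp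
    finally have "bigL k \<le> 2 * bits q + CARD('m)" by (simp add: bigL_def)
    then have J: "bigL k \<le> 4 * (bits q - 2 * sum k UNIV)" using k by linarith
    \<comment> \<open>Rounding in this division costs at most 4 * r in the bound for
      \<open>bigL k\<close>. This is at most half of \<open>bigL k\<close> because 8 * r \<le>
      \<open>bigL k\<close>, whence the constant 8 in \<open>mean_const\<close>.\<close>
    define t where "t = (bits q - 2 * sum k UNIV) div CARD('r)"
    have "bits q - 2 * sum k UNIV < CARD('r) * (t + 1)"
      unfolding t_def using dividend_less_times_div[of "CARD('r)" "bits q - 2 * sum k UNIV"] by simp
    then have "bigL k \<le> 4 * (CARD('r) * (t + 1))" using J by linarith
    moreover have "8 * CARD('r) \<le> bigL k" using k by linarith
    ultimately have "bigL k \<le> 8 * CARD('r) * t" by (simp add: algebra_simps)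
    then have "real (bigL k) \<le> real (8 * CARD('r) * t)" by (simp only: of_nat_le_iff)
    then have "real (bigL k) / (8 * real CARD('r)) \<le> real t" by (simp add: field_simps)
    then have "?c \<le> real t ^ CARD('r)" by (intro power_mono) auto
    also have "\<dots> = real (t ^ CARD('r))" by simp
    also have "\<dots> \<le> real (card (bulk k q))"
      unfolding t_def bulk_def by (subst of_nat_le_iff) (rule card_levels_ge)
    finally show ?thesis .
  qed
  have "(1 / 4) ^ CARD('m) * bigP k = (\<Prod>i\<in>UNIV. 2 ^ k i / 4)"
    by (simp add: bigP_def power_sum prod_dividef power_one_over)
  also have "\<dots> \<le> (\<Prod>i\<in>UNIV. \<Sum>n\<in>{2 ^ (2 ^ k i div 2)..<2 ^ 2 ^ k i}. 1 / max 1 (real n))"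
  proof (rule prod_mono, intro conjI)
    fix i
    have "2 ^ k i \<le> 2 * (2 ^ k i - 2 ^ k i div 2 :: nat)" by linarith
    then have "real (2 ^ k i) \<le> real (2 * (2 ^ k i - 2 ^ k i div 2))" by (simp only: of_nat_le_iff)
    then have "2 ^ k i / 4 \<le> real (2 ^ k i - 2 ^ k i div 2) / 2" by simp
    also have "\<dots> \<le> (\<Sum>n\<in>{2 ^ (2 ^ k i div 2)..<2 ^ 2 ^ k i}. 1 / real n)"
      by (rule harmonic_block_ge) simp
    also have "\<dots> = (\<Sum>n\<in>{2 ^ (2 ^ k i div 2)..<2 ^ 2 ^ k i}. 1 / max 1 (real n))"
    proof (rule sum.cong[OF refl])
      fix n :: nat assume "n \<in> {2 ^ (2 ^ k i div 2)..<2 ^ 2 ^ k i}"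
      then have "0 < n" by (metis atLeastLessThan_iff less_le_trans zero_less_numeral zero_less_power)
      then show "1 / real n = 1 / max 1 (real n)" by (simp add: max_def)
    qed
    finally show "2 ^ k i / 4 \<le> (\<Sum>n\<in>{2 ^ (2 ^ k i div 2)..<2 ^ 2 ^ k i}. 1 / max 1 (real n))" .
  qed simp
  also have "\<dots> = (\<Sum>q\<in>?D. weight q)" unfolding weight_def by (rule prod_sum_PiE) auto
  finally have w: "(1 / 4) ^ CARD('m) * bigP k \<le> (\<Sum>q\<in>?D. weight q)" .
  have "mean_const * growth k = ((1 / 4) ^ CARD('m) * bigP k) * ?c"
    by (simp add: mean_const_def growth_def power_divide mult_ac)
  also have "\<dots> \<le> (\<Sum>q\<in>?D. weight q) * ?c" by (intro mult_right_mono w) simp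
  also have "\<dots> = (\<Sum>q\<in>?D. weight q * ?c)" by (simp add: sum_distrib_right)
  also have "\<dots> \<le> (\<Sum>q\<in>?D. weight q * real (card (bulk k q)))"
    by (intro sum_mono mult_left_mono cnt) (auto intro: less_imp_le)
  also have "\<dots> \<le> (\<Sum>q\<in>qbox k. weight q * real (card (bulk k q)))"
    by (intro sum_mono2 sub) (auto intro: less_imp_le)
  also have "\<dots> = expectation (level_count k (bulk k))" by (simp add: expectation_level_count)
  finally show ?thesis .
qed

lemma expectation_bulk_le: "expectation (level_count k (bulk k)) \<le> 2 ^ CARD('m) * growth k"
proof -
  have "expectation (level_count k (bulk k)) = (\<Sum>q\<in>qbox k. weight q * real (card (bulk k q)))"
    by (simp add: expectation_level_count)
  also have "\<dots> \<le> (\<Sum>q\<in>qbox k. weight q * real (bigL k) ^ CARD('r))"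
    by (intro sum_mono mult_left_mono card_bulk_le) (auto intro: less_imp_le)
  also have "\<dots> \<le> (2 ^ CARD('m) * bigP k) * real (bigL k) ^ CARD('r)"
    unfolding sum_distrib_right[symmetric] by (intro mult_right_mono sum_weight_le) simp
  finally show ?thesis by (simp add: growth_def mult_ac)
qed

section \<open>Levels between and beyond the two cutoffs\<close>

lemma cutoff_le:
  assumes "q \<in> qbox k"
  shows "cutoff k q \<le> (CARD('r) + 3) * bigL k"
proof -
  have "(CARD('r) + 2) * sum k UNIV \<le> (CARD('r) + 2) * bigL k" by (intro mult_left_mono sum_le_bigL) simp
  then show ?thesis using bits_le_bigL[OF assms] by (simp add: cutoff_def algebra_simps)
qed

text \<open>The cutoffs are at most (2 + (r + 2)) * \<open>sum k UNIV\<close> layers apart, and each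
  layer has one power of \<open>bigL k\<close> less than the full simplex.\<close>

lemma card_edge_le:
  assumes q: "q \<in> qbox k"
  shows "card (edge k q) \<le> ((CARD('r) + 4) * sum k UNIV) * ((CARD('r) + 3) * bigL k) ^ (CARD('r) - 1)"
proof -
  let ?I = "{bits q - 2 * sum k UNIV..<cutoff k q}"
  have "edge k q = (\<Union>s\<in>?I. level s)" by (auto simp: edge_def bulk_def levels_def level_def)
  then have "card (edge k q) \<le> (\<Sum>s\<in>?I. card (level s :: ('r \<Rightarrow> nat) set))" by (simp add: card_UN_le)
  also have "\<dots> \<le> (\<Sum>s\<in>?I. ((CARD('r) + 3) * bigL k) ^ (CARD('r) - 1))"
  proof (rule sum_mono)
    fix s assume "s \<in> ?I"
    then have "s + 1 \<le> (CARD('r) + 3) * bigL k" using cutoff_le[OF q] by simp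
    then show "card (level s :: ('r \<Rightarrow> nat) set) \<le> ((CARD('r) + 3) * bigL k) ^ (CARD('r) - 1)"
      by (intro order_trans[OF card_level_le] power_mono) auto
  qed
  also have "\<dots> = card ?I * ((CARD('r) + 3) * bigL k) ^ (CARD('r) - 1)" by simp
  also have "\<dots> \<le> ((CARD('r) + 4) * sum k UNIV) * ((CARD('r) + 3) * bigL k) ^ (CARD('r) - 1)"
    by (intro mult_right_mono) (auto simp: cutoff_def algebra_simps)
  finally show ?thesis .
qed

definition edge_const :: real where
  "edge_const = 2 ^ CARD('m) * real (CARD('r) + 4) * real (CARD('r) + 3) ^ (CARD('r) - 1)"

lemma expectation_edge_le:
  "expectation (level_count k (edge k)) / growth k \<le> edge_const * ((1 + real (sum k UNIV)) / real (bigL k))"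
proof -
  let ?r = "CARD('r)" and ?L = "real (bigL k)" and ?s = "real (sum k UNIV)"
  let ?c = "(real (?r + 4) * (1 + ?s)) * (real (?r + 3) * ?L) ^ (?r - 1)"
  have L: "0 < ?L" using bigL_ge_1[of k] by simp
  have "expectation (level_count k (edge k)) = (\<Sum>q\<in>qbox k. weight q * real (card (edge k q)))"
    by (simp add: expectation_level_count)
  also have "\<dots> \<le> (\<Sum>q\<in>qbox k. weight q * ?c)"
  proof (intro sum_mono mult_left_mono)
    fix q assume "q \<in> qbox k"
    from card_edge_le[OF this] have "real (card (edge k q)) \<le> real (((?r + 4) * sum k UNIV) * ((?r + 3) * bigL k) ^ (?r - 1))"
      by (simp only: of_nat_le_iff)
    also have "\<dots> = (real (?r + 4) * ?s) * (real (?r + 3) * ?L) ^ (?r - 1)" by (simp only: of_nat_mult of_nat_power)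
    also have "\<dots> \<le> ?c" by (intro mult_right_mono mult_left_mono) (auto simp: sum_nonneg)
    finally show "real (card (edge k q)) \<le> ?c" .
  qed (auto intro: less_imp_le)
  also have "\<dots> \<le> (2 ^ CARD('m) * bigP k) * ?c"
    unfolding sum_distrib_right[symmetric]
    by (intro mult_right_mono sum_weight_le) (auto intro!: mult_nonneg_nonneg add_nonneg_nonneg sum_nonneg)
  also have "\<dots> = edge_const * ((1 + ?s) / ?L) * growth k"
  proof -
    have "?L ^ ?r = ?L * ?L ^ (?r - 1)" by (simp add: power_eq_if)
    then show ?thesis using L by (simp add: edge_const_def growth_def power_mult_distrib)
  qed
  finally show ?thesis using growth_pos[of k] by (simp add: pos_divide_le_eq)
qed

text \<open>Only the layer at the cutoff itself is listed: a hit at any deeper multi-index forces a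
  hit on this layer.\<close>

definition top_event :: "('m \<Rightarrow> nat) \<Rightarrow> 'a set" where
  "top_event k = (\<Union>q\<in>qbox k. \<Union>j\<in>level (cutoff k q). hit q j)"

lemma sets_top_event [measurable]: "top_event k \<in> events"
  unfolding top_event_def by (intro sets.finite_UN finite_qbox finite_level sets_hit)

lemma inverse_bigP_le: "1 / bigP (k :: 'm \<Rightarrow> nat) \<le> real CARD('m) * ((1 + real (sum k UNIV)) / real (bigL k))"
proof -
  have P: "0 < bigP k" using bigP_ge_1[of k] by simp
  have L: "0 < real (bigL k)" using bigL_ge_1[of k] by simp
  have "1 / bigP k \<le> real CARD('m) * (1 / real (bigL k))"
    using bigL_le[of k] P L by (simp add: field_simps)
  also have "\<dots> \<le> real CARD('m) * ((1 + real (sum k UNIV)) / real (bigL k))"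
    by (intro mult_left_mono divide_right_mono) (auto simp: sum_nonneg)
  finally show ?thesis .
qed

definition top_const :: real where
  "top_const = 4 ^ CARD('m) * (real (CARD('r) + 4) * real CARD('m)) ^ (CARD('r) - 1)"

text \<open>A union bound. The excess (r + 2) * \<open>sum k UNIV\<close> over the critical depth
  yields P^-(r+2), against at most a constant times P^(r-1) multi-indices per layer and a total
  weight of order P. What remains is P^-2.\<close>

lemma prob_top_event_le: "prob (top_event k) \<le> top_const * (1 / bigP k)"
proof -
  let ?r = "CARD('r)" and ?P = "bigP k" and ?m = "real CARD('m)"
  have P: "1 \<le> ?P" by (rule bigP_ge_1)
  have "prob (top_event k) \<le> (\<Sum>q\<in>qbox k. prob (\<Union>j\<in>level (cutoff k q). hit q j))"
    unfolding top_event_def by (intro measure_UNION_le) (auto intro!: sets.finite_UN)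
  also have "\<dots> \<le> (\<Sum>q\<in>qbox k. \<Sum>j\<in>level (cutoff k q). prob (hit q j))"
    by (intro sum_mono measure_UNION_le) auto
  also have "\<dots> = (\<Sum>q\<in>qbox k. real (card (level (cutoff k q) :: ('r \<Rightarrow> nat) set)) * (1 / 2) ^ cutoff k q)"
    by (intro sum.cong refl) (simp add: prob_hit qbox_nonzero level_def)
  also have "\<dots> \<le> (\<Sum>q\<in>qbox k. (real (?r + 4) * ?m * ?P) ^ (?r - 1) * (2 ^ CARD('m) * weight q * (1 / ?P ^ (?r + 2))))"
  proof (intro sum_mono mult_mono)
    fix q assume q: "q \<in> qbox k"
    have "cutoff k q + 1 \<le> (?r + 4) * bigL k" using cutoff_le[OF q] bigL_ge_1[of k] by (simp add: algebra_simps)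
    then have "card (level (cutoff k q) :: ('r \<Rightarrow> nat) set) \<le> ((?r + 4) * bigL k) ^ (?r - 1)"
      by (intro order_trans[OF card_level_le] power_mono) auto
    then have "real (card (level (cutoff k q) :: ('r \<Rightarrow> nat) set)) \<le> real (((?r + 4) * bigL k) ^ (?r - 1))"
      by (simp only: of_nat_le_iff)
    also have "\<dots> = (real (?r + 4) * real (bigL k)) ^ (?r - 1)" by (simp only: of_nat_mult of_nat_power)
    also have "\<dots> \<le> (real (?r + 4) * (?m * ?P)) ^ (?r - 1)"
      by (intro power_mono mult_left_mono bigL_le) auto
    finally show "real (card (level (cutoff k q) :: ('r \<Rightarrow> nat) set)) \<le> (real (?r + 4) * ?m * ?P) ^ (?r - 1)"
      by (simp only: mult.assoc)
    have "(1 / 2 :: real) ^ bits q \<le> 2 ^ CARD('m) * weight q"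
      using two_power_bits_ge[of q] by (simp add: power_one_over field_simps)
    then have "(1 / 2 :: real) ^ bits q * (1 / ?P ^ (?r + 2)) \<le> 2 ^ CARD('m) * weight q * (1 / ?P ^ (?r + 2))"
      using P by (intro mult_right_mono) auto
    moreover have "(1 / 2 :: real) ^ cutoff k q = (1 / 2) ^ bits q * (1 / ?P ^ (?r + 2))"
      unfolding cutoff_def bigP_def power_add[of _ "bits q"] power_mult[symmetric]
      by (simp add: power_one_over mult.commute)
    ultimately show "(1 / 2 :: real) ^ cutoff k q \<le> 2 ^ CARD('m) * weight q * (1 / ?P ^ (?r + 2))" by simp
  qed (use P in auto)
  also have "\<dots> = (real (?r + 4) * ?m * ?P) ^ (?r - 1) * (2 ^ CARD('m) * (1 / ?P ^ (?r + 2))) * (\<Sum>q\<in>qbox k. weight q)"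
    unfolding sum_distrib_left by (intro sum.cong refl) (simp only: mult_ac)
  also have "\<dots> \<le> (real (?r + 4) * ?m * ?P) ^ (?r - 1) * (2 ^ CARD('m) * (1 / ?P ^ (?r + 2))) * (2 ^ CARD('m) * ?P)"
    using P by (intro mult_left_mono sum_weight_le) auto
  also have "\<dots> = top_const * ((?P ^ (?r - 1) * ?P) / ?P ^ (?r + 2))"
    by (simp add: top_const_def power_mult_distrib) (simp add: mult_ac flip: power_mult_distrib)
  also have "\<dots> = top_const * (1 / ?P ^ 2)"
  proof -
    have "?P ^ (?r - 1) * ?P = ?P ^ ?r" by (simp add: power_eq_if mult.commute)
    then show ?thesis using P by (simp add: power_add power2_eq_square)
  qed
  also have "\<dots> \<le> top_const * (1 / ?P)"
    using P by (intro mult_left_mono divide_left_mono) (auto simp: top_const_def power2_eq_square)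
  finally show ?thesis .
qed

text \<open>A vanishing distance would be a hit at every depth. Such points must be excluded because
  division by zero yields 0 there, which would spoil the lower bound.\<close>

lemma AE_dnint_pos: "AE \<omega> in M. \<forall>q i. q \<noteq> (\<lambda>_. 0) \<longrightarrow> 0 < dnint (x q i \<omega>)"
proof -
  have "AE \<omega> in M. q \<noteq> (\<lambda>_. 0) \<longrightarrow> 0 < dnint (x q i \<omega>)" for q i
  proof (cases "q = (\<lambda>_. 0)")
    case False
    let ?N = "{\<omega> \<in> space M. dnint (x q i \<omega>) = 0}"
    have [measurable]: "?N \<in> events" by measurable
    have "prob ?N \<le> (1 / 2) ^ n" for n
    proof -
      \<comment> \<open>Depth 0 imposes no condition, as \<open>dnint\<close> is at most 1 / 2; only
        the coordinate i is tested.\<close>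
      let ?j = "\<lambda>i'. if i' = i then n else 0"
      have "2 * dnint y \<le> 1" for y using dnint_le_half[of y] by simp
      then have "?N \<subseteq> hit q ?j" by (auto simp: hit_def deep_def)
      then have "prob ?N \<le> prob (hit q ?j)" by (intro finite_measure_mono) auto
      then show ?thesis by (simp add: prob_hit[OF False])
    qed
    then have "prob ?N \<le> 0"
      by (intro LIMSEQ_le_const[OF LIMSEQ_power_zero[of "1 / 2 :: real"]]) auto
    then have "prob ?N = 0" using measure_nonneg[of M ?N] by linarith
    then have "?N \<in> null_sets M" by (simp add: null_sets_def emeasure_eq_measure)
    then show ?thesis
      by (rule AE_I') (auto simp: order.not_eq_order_implies_strict order_less_le)
  qed simp
  then show ?thesis by (simp add: AE_all_countable)
qed

lemma recip_sum_pos: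
  assumes "\<And>q i. q \<noteq> (\<lambda>_. 0) \<Longrightarrow> 0 < dnint (x q i \<omega>)"
  shows "0 < recip_sum k \<omega>"
  unfolding recip_sum_def
proof (rule sum_pos)
  have "1 < (2::nat) ^ 2 ^ k i" for i by (rule one_less_power) auto
  then have "(\<lambda>_. 1) \<in> qbox k" by (simp add: qbox_def fun_eq_iff)
  then show "qbox k \<noteq> {}" by blast
  show "0 < weight q * (\<Prod>i\<in>UNIV. 1 / dnint (x q i \<omega>))" if "q \<in> qbox k" for q
    using assms[OF qbox_nonzero[OF that]] by (intro mult_pos_pos prod_pos) auto
qed simp

section \<open>Almost sure comparison of the reciprocal sum with its levels\<close>

lemma level_count_levels:
  assumes "\<omega> \<in> space M"
  shows "level_count k (\<lambda>q. levels (J q)) \<omega> = (\<Sum>q\<in>qbox k. weight q *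
    (\<Sum>j\<in>levels (J q). if \<forall>i. deep (j i) (x q i \<omega>) then 2 ^ sum j UNIV else 0))"
  unfolding level_count_def sum_distrib_left
  using assms by (intro sum.cong refl) (auto simp: indicator_def hit_def)

lemma bulk_le_recip_sum:
  assumes "\<omega> \<in> space M" "\<And>q i. q \<noteq> (\<lambda>_. 0) \<Longrightarrow> 0 < dnint (x q i \<omega>)"
  shows "level_count k (bulk k) \<omega> \<le> recip_sum k \<omega>"
proof -
  have "level_count k (bulk k) \<omega> = level_count k (\<lambda>q. levels (bits q - 2 * sum k UNIV)) \<omega>"
    by (simp add: level_count_def bulk_def)
  also have "\<dots> \<le> recip_sum k \<omega>"
    unfolding level_count_levels[OF assms(1)] recip_sum_def
    by (intro sum_mono mult_left_mono levels_sum_le_prod assms(2) qbox_nonzero) auto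
  finally show ?thesis .
qed

lemma recip_sum_le:
  assumes \<omega>: "\<omega> \<in> space M" "\<omega> \<notin> top_event k" and pos: "\<And>q i. q \<noteq> (\<lambda>_. 0) \<Longrightarrow> 0 < dnint (x q i \<omega>)"
  shows "recip_sum k \<omega> \<le> 4 ^ CARD('r) * (level_count k (bulk k) \<omega> + level_count k (edge k) \<omega>)"
proof -
  have "recip_sum k \<omega> \<le> (\<Sum>q\<in>qbox k. weight q * (4 ^ CARD('r) *
      (\<Sum>j\<in>levels (cutoff k q). if \<forall>i. deep (j i) (x q i \<omega>) then 2 ^ sum j UNIV else 0)))"
    unfolding recip_sum_def
  proof (intro sum_mono mult_left_mono prod_le_levels_sum pos qbox_nonzero)
    fix q and j :: "'r \<Rightarrow> nat" assume "q \<in> qbox k" "j \<in> level (cutoff k q)"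
    then have "\<omega> \<notin> hit q j" using \<omega>(2) by (auto simp: top_event_def)
    then show "\<exists>i. \<not> deep (j i) (x q i \<omega>)" using \<omega>(1) by (auto simp: hit_def)
  qed auto
  also have "\<dots> = 4 ^ CARD('r) * level_count k (\<lambda>q. levels (cutoff k q)) \<omega>"
    unfolding level_count_levels[OF \<omega>(1)] sum_distrib_left by (intro sum.cong refl) (simp only: mult_ac)
  also have "level_count k (\<lambda>q. levels (cutoff k q)) \<omega> = level_count k (bulk k) \<omega> + level_count k (edge k) \<omega>"
    unfolding level_count_def sum.distrib[symmetric]
  proof (intro sum.cong refl)
    fix q
    have "bulk k q \<subseteq> levels (cutoff k q)" by (auto simp: bulk_def levels_def cutoff_def)
    then show "(\<Sum>j\<in>levels (cutoff k q). weight q * 2 ^ sum j UNIV * indicator (hit q j) \<omega>)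
      = (\<Sum>j\<in>bulk k q. weight q * 2 ^ sum j UNIV * indicator (hit q j) \<omega>)
      + (\<Sum>j\<in>edge k q. weight q * 2 ^ sum j UNIV * indicator (hit q j) \<omega>)"
      unfolding edge_def by (subst add.commute) (intro sum.subset_diff; simp)
  qed
  finally show ?thesis .
qed

lemma mean_const_pos: "0 < mean_const"
  by (simp add: mean_const_def)

lemma measurable_level_count [measurable]: "(\<And>q. finite (D q)) \<Longrightarrow> level_count k D \<in> borel_measurable M"
  unfolding level_count_def[abs_def] by measurable

lemma level_count_nonneg: "0 \<le> level_count k D \<omega>"
  unfolding level_count_def by (intro sum_nonneg mult_nonneg_nonneg) auto

text \<open>Chebyshev's inequality at half the lower bound for the mean. The relative variance is of
  order L^2 / P^3, and L \<le> \<open>CARD('m)\<close> * P turns this into a multiple of 1 /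
  P.\<close>

lemma AE_finite_deviation:
  "AE \<omega> in M. finite {k. \<omega> \<in> {\<omega> \<in> space M. mean_const / 2 * growth k
      \<le> \<bar>level_count k (bulk k) \<omega> - expectation (level_count k (bulk k))\<bar>}}"
proof (rule AE_finite_events)
  let ?K = "2 ^ (CARD('r) + CARD('m)) * (4 / mean_const\<^sup>2) * real CARD('m) ^ 2 * real CARD('m)"
  show "(\<lambda>k::'m \<Rightarrow> nat. ?K * ((1 + real (sum k UNIV)) / real (bigL k))) summable_on UNIV"
    by (rule summable_on_cmult_right[OF summable_on_ratio])
  fix k :: "'m \<Rightarrow> nat"
  have P: "0 < bigP k" using bigP_ge_1[of k] by simp
  have L: "0 < real (bigL k)" using bigL_ge_1[of k] by simp
  have [measurable]: "level_count k (bulk k) \<in> borel_measurable M" by measurable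
  show "{\<omega> \<in> space M. mean_const / 2 * growth k \<le> \<bar>level_count k (bulk k) \<omega> - expectation (level_count k (bulk k))\<bar>} \<in> events"
    by measurable
  have "integrable M (\<lambda>\<omega>. (level_count k (bulk k) \<omega>)\<^sup>2)"
    unfolding level_count_eq_sum[OF finite_bulk] by (rule variance_sum_indicator(2)) auto
  then have "prob {\<omega> \<in> space M. mean_const / 2 * growth k \<le> \<bar>level_count k (bulk k) \<omega> - expectation (level_count k (bulk k))\<bar>}
      \<le> variance (level_count k (bulk k)) / (mean_const / 2 * growth k)\<^sup>2"
    using mean_const_pos growth_pos[of k] by (intro Chebyshev_inequality) auto
  also have "\<dots> \<le> (2 ^ (CARD('r) + CARD('m)) * real (bigL k) ^ (2 * CARD('r) + 2) / bigP k) / (mean_const / 2 * growth k)\<^sup>2"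
    by (intro divide_right_mono variance_bulk_le) simp
  also have "\<dots> = 2 ^ (CARD('r) + CARD('m)) * (4 / mean_const\<^sup>2) * (real (bigL k))\<^sup>2 * (1 / bigP k ^ 3)"
  proof -
    have e1: "(mean_const / 2 * growth k)\<^sup>2 = mean_const\<^sup>2 / 4 * (real (bigL k) ^ (2 * CARD('r)) * (bigP k)\<^sup>2)"
      by (simp add: growth_def power_mult_distrib power_divide power_even_eq)
    have e2: "real (bigL k) ^ (2 * CARD('r) + 2) = real (bigL k) ^ (2 * CARD('r)) * (real (bigL k))\<^sup>2"
      by (simp only: power_add)
    have e3: "A * (E * l) / p / (m / 4 * (E * p\<^sup>2)) = A * (4 / m) * l * (1 / p ^ 3)"
      if "E \<noteq> 0" "p \<noteq> 0" for A E l p m :: real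
      using that by (simp add: field_simps power2_eq_square power3_eq_cube)
    show ?thesis unfolding e1 e2 by (rule e3) (use P L in auto)
  qed
  also have "\<dots> \<le> 2 ^ (CARD('r) + CARD('m)) * (4 / mean_const\<^sup>2) * (real CARD('m) * bigP k)\<^sup>2 * (1 / bigP k ^ 3)"
    using P L by (intro mult_right_mono mult_left_mono power_mono bigL_le) auto
  also have "\<dots> = 2 ^ (CARD('r) + CARD('m)) * (4 / mean_const\<^sup>2) * (real CARD('m))\<^sup>2 * (1 / bigP k)"
    using P by (simp add: power_mult_distrib power2_eq_square power3_eq_cube)
  also have "\<dots> \<le> 2 ^ (CARD('r) + CARD('m)) * (4 / mean_const\<^sup>2) * (real CARD('m))\<^sup>2
      * (real CARD('m) * ((1 + real (sum k UNIV)) / real (bigL k)))"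
    by (intro mult_left_mono inverse_bigP_le) auto
  finally show "prob {\<omega> \<in> space M. mean_const / 2 * growth k \<le> \<bar>level_count k (bulk k) \<omega> - expectation (level_count k (bulk k))\<bar>}
      \<le> ?K * ((1 + real (sum k UNIV)) / real (bigL k))" by (simp only: mult.assoc)
qed

lemma AE_finite_edge: "AE \<omega> in M. finite {k. \<omega> \<in> {\<omega> \<in> space M. growth k \<le> level_count k (edge k) \<omega>}}"
proof (rule AE_finite_events)
  show "(\<lambda>k::'m \<Rightarrow> nat. edge_const * ((1 + real (sum k UNIV)) / real (bigL k))) summable_on UNIV"
    by (rule summable_on_cmult_right[OF summable_on_ratio])
  fix k :: "'m \<Rightarrow> nat"
  have [measurable]: "level_count k (edge k) \<in> borel_measurable M" by measurable
  show "{\<omega> \<in> space M. growth k \<le> level_count k (edge k) \<omega>} \<in> events" by measurable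
  have "integrable M (\<lambda>\<omega>. (level_count k (edge k) \<omega>)\<^sup>2)"
    unfolding level_count_eq_sum[OF finite_edge] by (rule variance_sum_indicator(2)) auto
  then have "integrable M (level_count k (edge k))" by (rule square_integrable_imp_integrable[rotated]) measurable
  then have "prob {\<omega> \<in> space M. growth k \<le> level_count k (edge k) \<omega>} \<le> expectation (level_count k (edge k)) / growth k"
    using growth_pos[of k] by (intro integral_Markov_inequality_measure[where A = "{}"])
      (auto simp: level_count_nonneg)
  also have "\<dots> \<le> edge_const * ((1 + real (sum k UNIV)) / real (bigL k))" by (rule expectation_edge_le)
  finally show "prob {\<omega> \<in> space M. growth k \<le> level_count k (edge k) \<omega>}
      \<le> edge_const * ((1 + real (sum k UNIV)) / real (bigL k))" .
qed

lemma AE_finite_top: "AE \<omega> in M. finite {k. \<omega> \<in> top_event k}"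
proof (rule AE_finite_events)
  show "(\<lambda>k::'m \<Rightarrow> nat. top_const * real CARD('m) * ((1 + real (sum k UNIV)) / real (bigL k))) summable_on UNIV"
    by (rule summable_on_cmult_right[OF summable_on_ratio])
  fix k :: "'m \<Rightarrow> nat"
  have "prob (top_event k) \<le> top_const * (1 / bigP k)" by (rule prob_top_event_le)
  also have "\<dots> \<le> top_const * (real CARD('m) * ((1 + real (sum k UNIV)) / real (bigL k)))"
    by (intro mult_left_mono inverse_bigP_le) (simp add: top_const_def)
  finally show "prob (top_event k) \<le> top_const * real CARD('m) * ((1 + real (sum k UNIV)) / real (bigL k))"
    by (simp only: mult.assoc)
qed (rule sets_top_event)

text \<open>For such k the ratio of \<open>summable_on_ratio\<close> stays above a fixed positive
  constant, which a summable family can do only finitely often.\<close>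

lemma finite_small_boxes: "finite {k::'m \<Rightarrow> nat. bigL k < 2 * CARD('m) + 8 * sum k UNIV + 8 * CARD('r)}"
proof -
  let ?e = "1 / real (2 * CARD('m) + 8 + 8 * CARD('r))"
  have "finite {k::'m \<Rightarrow> nat. ?e \<le> (1 + real (sum k UNIV)) / real (bigL k)}"
    by (rule finite_ge_if_summable_on[OF summable_on_ratio]) (auto intro!: divide_nonneg_nonneg add_nonneg_nonneg sum_nonneg)
  moreover have "{k::'m \<Rightarrow> nat. bigL k < 2 * CARD('m) + 8 * sum k UNIV + 8 * CARD('r)}
      \<subseteq> {k. ?e \<le> (1 + real (sum k UNIV)) / real (bigL k)}"
  proof clarify
    fix k :: "'m \<Rightarrow> nat"
    let ?c = "2 * CARD('m) + 8 + 8 * CARD('r)"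
    assume "bigL k < 2 * CARD('m) + 8 * sum k UNIV + 8 * CARD('r)"
    then have "bigL k \<le> ?c * (1 + sum k UNIV)" by (simp add: algebra_simps)
    then have "real (bigL k) \<le> real (?c * (1 + sum k UNIV))" by (simp only: of_nat_le_iff)
    then have le: "real (bigL k) \<le> real ?c * (1 + real (sum k UNIV))" by (simp only: of_nat_mult of_nat_add of_nat_1)
    have c: "0 < real ?c" by linarith
    have "0 < real (bigL k)" using bigL_ge_1[of k] by simp
    moreover have "1 / c \<le> s / l" if "l \<le> c * s" "0 < c" "0 < l" for c s l :: real
      using that by (simp add: field_simps)
    ultimately show "?e \<le> (1 + real (sum k UNIV)) / real (bigL k)" using le c by blast
  qed
  ultimately show ?thesis by (rule rev_finite_subset)
qed

theorem AE_recip_sum_asymp: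
  "AE \<omega> in M. \<exists>c>0. \<exists>C>0. \<forall>k. c * growth k \<le> recip_sum k \<omega> \<and> recip_sum k \<omega> \<le> C * growth k"
  using AE_dnint_pos AE_finite_deviation AE_finite_edge AE_finite_top AE_space
proof eventually_elim
  case (elim \<omega>)
  then have \<omega>: "\<omega> \<in> space M" and pos: "\<And>q i. q \<noteq> (\<lambda>_. 0) \<Longrightarrow> 0 < dnint (x q i \<omega>)" by auto
  let ?X = "\<lambda>k. level_count k (bulk k) \<omega>" and ?E = "\<lambda>k. expectation (level_count k (bulk k))"
  define B where "B = {k. mean_const / 2 * growth k \<le> \<bar>?X k - ?E k\<bar>} \<union> {k. growth k \<le> level_count k (edge k) \<omega>}
    \<union> {k. \<omega> \<in> top_event k} \<union> {k. bigL k < 2 * CARD('m) + 8 * sum k UNIV + 8 * CARD('r)}"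
  have fin: "finite B" unfolding B_def using elim finite_small_boxes by simp
  \<comment> \<open>A factor 4 per phase is lost to dyadic rounding. The summands bound, in units of
    \<open>growth k\<close>, the mean of the bulk, its deviation and the edge.\<close>
  let ?C = "4 ^ CARD('r) * (2 ^ CARD('m) + mean_const / 2 + 1)"
  have "mean_const / 2 * growth k \<le> recip_sum k \<omega> \<and> recip_sum k \<omega> \<le> ?C * growth k" if "k \<notin> B" for k
  proof
    have k: "\<bar>?X k - ?E k\<bar> < mean_const / 2 * growth k" "level_count k (edge k) \<omega> < growth k" "\<omega> \<notin> top_event k"
      "2 * CARD('m) + 8 * sum k UNIV + 8 * CARD('r) \<le> bigL k"
      using that by (auto simp: B_def not_le not_less)
    have "mean_const * growth k \<le> ?E k" using k(4) by (rule expectation_bulk_ge)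
    then have "mean_const / 2 * growth k \<le> ?X k" using k(1) unfolding abs_less_iff by linarith
    also have "\<dots> \<le> recip_sum k \<omega>" by (intro bulk_le_recip_sum \<omega> pos)
    finally show "mean_const / 2 * growth k \<le> recip_sum k \<omega>" .
    have "?X k + level_count k (edge k) \<omega> \<le> (2 ^ CARD('m) + mean_const / 2 + 1) * growth k"
      using k(1,2) expectation_bulk_le[of k] unfolding abs_less_iff distrib_right by linarith
    then have *: "4 ^ CARD('r) * (?X k + level_count k (edge k) \<omega>) \<le> 4 ^ CARD('r) * ((2 ^ CARD('m) + mean_const / 2 + 1) * growth k)"
      by (intro mult_left_mono) auto
    have "recip_sum k \<omega> \<le> 4 ^ CARD('r) * (?X k + level_count k (edge k) \<omega>)"
      by (intro recip_sum_le \<omega> k(3) pos)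
    also note *
    finally show "recip_sum k \<omega> \<le> ?C * growth k" by (simp only: mult.assoc)
  qed
  moreover have "0 < recip_sum k \<omega>" for k by (intro recip_sum_pos pos)
  moreover have "0 < ?C" using mean_const_pos by (intro mult_pos_pos add_pos_pos) auto
  ultimately show ?case
    using fin growth_pos mean_const_pos
    by (intro two_sided_bounds_extend[of B _ _ "mean_const / 2" ?C]) (blast | simp)+
qed

text \<open>Free of the constants of the locale, so that it can be applied directly to concrete
  phases.\<close>

theorem AE_weighted_sum_asymp:
  "AE \<omega> in M. \<exists>c>0. \<exists>C>0. \<forall>k.
     c * (real (bigL k) ^ CARD('r) * bigP k) \<le> (\<Sum>q\<in>qbox k. weight q * (\<Prod>i\<in>UNIV. 1 / dnint (x q i \<omega>))) \<and>
     (\<Sum>q\<in>qbox k. weight q * (\<Prod>i\<in>UNIV. 1 / dnint (x q i \<omega>))) \<le> C * (real (bigL k) ^ CARD('r) * bigP k)"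
  using AE_recip_sum_asymp unfolding growth_def recip_sum_def .

end

subsection \<open>Phases on the torus\<close>

lemma deep_iff: "deep j y \<longleftrightarrow> dnint y \<le> (1 / 2) ^ j / 2"
  by (simp add: deep_def field_simps power_one_over)

lemma periodic_UNIV: "periodic UNIV"
  by (simp add: periodic_def)

text \<open>Cancelling the gcd at one common nonzero coordinate gives a and b; coprimality then
  forces a to divide every entry of q. Contraposed: vectors that are not parallel have a nonzero 2
  by 2 minor.\<close>

lemma proportional_imp_multiples:
  fixes q q' :: "'m::finite \<Rightarrow> nat"
  assumes nz: "q \<noteq> (\<lambda>_. 0)" "q' \<noteq> (\<lambda>_. 0)" and cross: "\<And>s t. q s * q' t = q t * q' s"
  shows "\<exists>u a b. 0 < a \<and> 0 < b \<and> coprime a b \<and> q = (\<lambda>i. a * u i) \<and> q' = (\<lambda>i. b * u i)"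
proof -
  obtain t0 where t0: "q t0 \<noteq> 0" using nz by auto
  obtain t1 where t1: "q' t1 \<noteq> 0" using nz by auto
  have q't0: "q' t0 \<noteq> 0"
  proof
    assume "q' t0 = 0"
    then show False using cross[of t0 t1] t0 t1 by simp
  qed
  define g where "g = gcd (q t0) (q' t0)"
  have g: "g \<noteq> 0" using t0 by (simp add: g_def)
  define a where "a = q t0 div g"
  define b where "b = q' t0 div g"
  have a: "q t0 = a * g" and b: "q' t0 = b * g" by (simp_all add: a_def b_def g_def)
  have cop: "coprime a b" unfolding a_def b_def g_def by (rule div_gcd_coprime) (use t0 in auto)
  have pos: "0 < a" "0 < b" using a b t0 q't0 by (auto intro!: gr0I)
  have eq: "b * q t = a * q' t" for t
  proof -
    have "a * g * q' t = q t * (b * g)" using cross[of t0 t] a b by simp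
    then have "g * (b * q t) = g * (a * q' t)" by (auto simp: mult_ac)
    then show ?thesis using g by simp
  qed
  define u where "u t = q t div a" for t
  have q: "q t = a * u t" for t
  proof -
    have "a dvd b * q t" using eq[of t] by simp
    then have "a dvd q t" using cop by (simp add: coprime_dvd_mult_right_iff)
    then show ?thesis by (simp add: u_def)
  qed
  have q': "q' t = b * u t" for t
  proof -
    have "a * q' t = a * (b * u t)" using eq[of t] q[of t] by (auto simp: mult_ac)
    then show ?thesis using pos by simp
  qed
  show ?thesis using pos cop q q' by blast
qed

definition dot :: "('n::finite \<Rightarrow> nat) \<Rightarrow> real ^ 'n \<Rightarrow> real" where
  "dot q \<alpha> = (\<Sum>t\<in>UNIV. real (q t) * \<alpha> $ t)"

lemma integral_functional_dot: "integral_functional (dot q)"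
  unfolding integral_functional_def
proof
  show "linear (dot q)"
    by (rule linearI) (simp_all add: dot_def sum.distrib sum_distrib_left algebra_simps)
  show "\<forall>m. dot q (lattice_vec m) \<in> \<int>"
    by (auto simp: dot_def lattice_vec_def intro!: Ints_sum Ints_mult)
qed

lemma dot_add: "dot q (\<alpha> + \<beta>) = dot q \<alpha> + dot q \<beta>"
  by (simp add: dot_def sum.distrib algebra_simps)

lemma dot_scale: "dot q (\<tau> *\<^sub>R \<alpha>) = \<tau> * dot q \<alpha>"
  by (simp add: dot_def sum_distrib_left algebra_simps)

lemma dot_axis: "dot q (axis t c) = real (q t) * c"
  by (simp add: dot_def axis_def if_distrib cong: if_cong)

lemma dot_mult: "dot (\<lambda>t. a * q t) \<alpha> = real a * dot q \<alpha>"
  by (simp add: dot_def sum_distrib_left mult_ac)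

lemma dot_eq_1:
  assumes "q \<noteq> (\<lambda>_. 0)"
  obtains u where "dot q u = 1"
proof -
  obtain t where "q t \<noteq> 0" using assms by auto
  then have "dot q (axis t (1 / real (q t))) = 1" by (simp add: dot_axis)
  then show ?thesis by (rule that)
qed

lemma half_power_bounds: "0 \<le> (1 / 2 :: real) ^ j / 2" "(1 / 2 :: real) ^ j / 2 \<le> 1 / 2"
  using power_le_one[of "1 / 2 :: real" j] by auto

text \<open>The count in \<open>measure_torus_dnint_le_pair\<close> treats the two multipliers
  asymmetrically; using it in both orders and keeping the better bound produces the minimum.\<close>

lemma le_mult_add_min:
  fixes p g A B a b :: real
  assumes "p \<le> g * (A * (B + 1 / a))" "p \<le> g * (B * (A + 1 / b))"
  shows "p \<le> g * (A * B + min (A / a) (B / b))"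
  using assms by (cases "A / a \<le> B / b") (simp_all add: min_def algebra_simps)

text \<open>For vectors that are not parallel there is a direction orthogonal to one and of product
  1 with the other. The first event is invariant along it, so the two events are exactly
  independent.\<close>

lemma lattice_phases_dot: "lattice_phases torus (\<lambda>(q :: 'n::finite \<Rightarrow> nat) (_ :: unit) \<alpha>. dot q \<alpha>)"
proof -
  interpret prob_space "torus :: (real ^ 'n) measure" by (rule prob_space_torus)
  let ?H = "\<lambda>q (j :: unit \<Rightarrow> nat). {\<alpha> \<in> space (torus :: (real ^ 'n) measure). \<forall>i::unit. deep (j i) (dot q \<alpha>)}"
  have H: "?H q j = {\<alpha>. dnint (dot q \<alpha>) \<le> (1 / 2) ^ j () / 2}" for q j by (simp add: deep_iff)
  have sum1: "sum j UNIV = j ()" for j :: "unit \<Rightarrow> nat" by (simp add: UNIV_unit)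
  have single: "prob (?H q j) = (1 / 2) ^ sum j UNIV" if nz: "q \<noteq> (\<lambda>_. 0)" for q j
  proof -
    obtain u where u: "dot q u = 1" using dot_eq_1[OF nz] .
    from measure_torus_dnint_le[OF _ periodic_UNIV _ integral_functional_dot u half_power_bounds, of "j ()"]
    show ?thesis unfolding H sum1 using prob_space by simp
  qed
  show ?thesis
  proof
    show "(\<lambda>\<alpha>. dot q \<alpha>) \<in> borel_measurable torus" for q :: "'n \<Rightarrow> nat"
      using integral_functional_measurable[OF integral_functional_dot[of q]] by simp
    show "prob (?H q j) = (1 / 2) ^ sum j UNIV" if "q \<noteq> (\<lambda>_. 0)" for q j by (rule single[OF that])
    show "prob (?H (\<lambda>i. a * u i) j \<inter> ?H (\<lambda>i. b * u i) l)
        \<le> (\<Prod>i\<in>UNIV. (1 / 2) ^ (j i + l i) + min ((1 / 2) ^ j i / real a) ((1 / 2) ^ l i / real b))"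
      if nz: "u \<noteq> (\<lambda>_. 0)" and ab: "0 < a" "0 < b" "coprime a b" for u a b j l
    proof -
      obtain v where v: "dot u v = 1" using dot_eq_1[OF nz] .
      let ?A = "{\<alpha>. dnint (real a * dot u \<alpha>) \<le> (1 / 2) ^ j () / 2}"
        and ?B = "{\<alpha>. dnint (real b * dot u \<alpha>) \<le> (1 / 2) ^ l () / 2}"
      have 1: "prob (?A \<inter> ?B) \<le> 1 * ((1 / 2) ^ j () * ((1 / 2) ^ l () + 1 / real a))"
        using measure_torus_dnint_le_pair[OF _ periodic_UNIV _ integral_functional_dot v half_power_bounds half_power_bounds(1) ab(1,3),
            of "j ()" "l ()"] prob_space by simp
      have ba: "coprime b a" using ab(3) by (simp add: coprime_commute)
      have 2: "prob (?B \<inter> ?A) \<le> 1 * ((1 / 2) ^ l () * ((1 / 2) ^ j () + 1 / real b))"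
        using measure_torus_dnint_le_pair[OF _ periodic_UNIV _ integral_functional_dot v half_power_bounds half_power_bounds(1) ab(2) ba,
            of "l ()" "j ()"] prob_space by simp
      have "prob (?A \<inter> ?B) \<le> (1 / 2) ^ (j () + l ()) + min ((1 / 2) ^ j () / real a) ((1 / 2) ^ l () / real b)"
        using le_mult_add_min[OF 1 2[unfolded Int_commute[of ?B]]] by (simp only: power_add mult_1)
      then show ?thesis by (simp add: UNIV_unit dot_mult deep_iff)
    qed
    show "prob (?H q j \<inter> ?H q' l) \<le> (1 / 2) ^ sum j UNIV * (1 / 2) ^ sum l UNIV"
      if nz: "q \<noteq> (\<lambda>_. 0)" "q' \<noteq> (\<lambda>_. 0)" and
        np: "\<not> (\<exists>u a b. 0 < a \<and> 0 < b \<and> coprime a b \<and> q = (\<lambda>i. a * u i) \<and> q' = (\<lambda>i. b * u i))"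
      for q q' j l
    proof -
      obtain s t where st: "q s * q' t \<noteq> q t * q' s"
        using proportional_imp_multiples[OF nz] np by blast
      \<comment> \<open>A nonvanishing 2 by 2 minor of q and q'. By Cramer's rule it provides v,
        supported on the coordinates s and t, with q . v = 0 and q' . v = 1.\<close>
      define D where "D = real (q' s) * real (q t) - real (q' t) * real (q s)"
      have "real (q s * q' t) \<noteq> real (q t * q' s)" using st of_nat_eq_iff by blast
      then have D: "D \<noteq> 0" by (simp add: D_def mult.commute)
      define v :: "real ^ 'n" where "v = (1 / D) *\<^sub>R (axis s (real (q t)) + axis t (- real (q s)))"
      have qv: "dot q v = 0" by (simp add: v_def dot_scale dot_add dot_axis)
      have "dot q' v = (1 / D) * D" by (simp add: v_def dot_scale dot_add dot_axis D_def)
      then have q'v: "dot q' v = 1" using D by simp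
      let ?G = "{\<alpha>. dnint (dot q \<alpha> + 0) \<le> (1 / 2) ^ j () / 2}"
      have "prob (?G \<inter> {\<alpha>. dnint (dot q' \<alpha>) \<le> (1 / 2) ^ l () / 2}) = prob ?G * (2 * ((1 / 2) ^ l () / 2))"
      proof (rule measure_torus_dnint_le[where u = v])
        show "?G \<in> sets borel" "periodic ?G"
          by (intro sets_dnint_le periodic_dnint_le integral_functional_dot)+
        show "\<alpha> + \<tau> *\<^sub>R v \<in> ?G \<longleftrightarrow> \<alpha> \<in> ?G" for \<alpha> \<tau> by (simp add: dot_add dot_scale qv)
      qed (use q'v half_power_bounds integral_functional_dot in auto)
      moreover have "prob ?G = (1 / 2) ^ sum j UNIV" using single[OF nz(1), of j] by (simp add: deep_iff)
      ultimately show ?thesis unfolding H by (simp add: sum1)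
    qed
  qed
qed

lemma integral_functional_coordinate: "integral_functional (\<lambda>\<alpha>. real n * \<alpha> $ i)"
  unfolding integral_functional_def
  by (auto intro!: linearI Ints_mult simp: algebra_simps lattice_vec_def)

text \<open>Events are built up one coordinate at a time: what has been imposed on the coordinates
  in I is invariant along any other axis, so each new coordinate contributes its own factor.\<close>

lemma lattice_phases_coordinates: "lattice_phases torus (\<lambda>(q :: unit \<Rightarrow> nat) (i :: 'n::finite) \<alpha>. real (q ()) * \<alpha> $ i)"
proof -
  interpret prob_space "torus :: (real ^ 'n) measure" by (rule prob_space_torus)
  let ?x = "\<lambda>(q :: unit \<Rightarrow> nat) (i :: 'n) (\<alpha> :: real ^ 'n). real (q ()) * \<alpha> $ i"
  let ?H = "\<lambda>q j. {\<alpha> \<in> space torus. \<forall>i. deep (j i) (?x q i \<alpha>)}"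
  have coord: "(\<alpha> + \<tau> *\<^sub>R axis i c) $ i' = \<alpha> $ i'" if "i' \<noteq> i" for \<alpha> :: "real ^ 'n" and \<tau> c i i'
    using that by (simp add: axis_def)
  have per: "periodic {\<alpha>. \<forall>i\<in>I. dnint (real n * \<alpha> $ i) \<le> s i}"
    and sets: "{\<alpha>. \<forall>i\<in>I. dnint (real n * \<alpha> $ i) \<le> s i} \<in> sets borel" for n s and I :: "'n set"
  proof -
    have "dnint (real n * (\<alpha> + lattice_vec m) $ i) = dnint (real n * \<alpha> $ i)" for \<alpha> m and i :: 'n
      unfolding vector_add_component distrib_left by (rule dnint_add_Ints) (auto simp: lattice_vec_def intro!: Ints_mult)
    then show "periodic {\<alpha>. \<forall>i\<in>I. dnint (real n * \<alpha> $ i) \<le> s i}" by (auto simp only: periodic_def mem_Collect_eq)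
    show "{\<alpha>. \<forall>i\<in>I. dnint (real n * \<alpha> $ i) \<le> s i} \<in> sets borel" by measurable
  qed
  have single: "prob {\<alpha>. \<forall>i\<in>I. dnint (real n * \<alpha> $ i) \<le> (1 / 2) ^ j i / 2} = (\<Prod>i\<in>I. (1 / 2) ^ j i)"
    if n: "0 < n" for n j and I :: "'n set"
  proof (induction I rule: infinite_finite_induct)
    case (insert i I)
    let ?G = "{\<alpha>. \<forall>i\<in>I. dnint (real n * \<alpha> $ i) \<le> (1 / 2) ^ j i / 2}"
    have "prob (?G \<inter> {\<alpha>. dnint (real n * \<alpha> $ i) \<le> (1 / 2) ^ j i / 2}) = prob ?G * (2 * ((1 / 2) ^ j i / 2))"
    proof (rule measure_torus_dnint_le[OF sets per _ integral_functional_coordinate _ half_power_bounds])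
      have "(\<alpha> + \<tau> *\<^sub>R axis i (1 / real n)) $ i' = \<alpha> $ i'" if "i' \<in> I" for \<alpha> :: "real ^ 'n" and \<tau> i'
        using that insert by (intro coord) auto
      then show "\<alpha> + \<tau> *\<^sub>R axis i (1 / real n) \<in> ?G \<longleftrightarrow> \<alpha> \<in> ?G" for \<alpha> \<tau>
        by (auto simp only: mem_Collect_eq)
      show "real n * axis i (1 / real n) $ i = 1" using n by (simp add: axis_def)
    qed
    moreover have "?G \<inter> {\<alpha>. dnint (real n * \<alpha> $ i) \<le> (1 / 2) ^ j i / 2} = {\<alpha>. \<forall>i\<in>insert i I. dnint (real n * \<alpha> $ i) \<le> (1 / 2) ^ j i / 2}"
      by auto
    ultimately show ?case using insert by (simp add: mult.commute)
  qed (use prob_space in auto)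
  have pair: "prob ({\<alpha>. \<forall>i\<in>I. dnint (real (a * n) * \<alpha> $ i) \<le> (1 / 2) ^ j i / 2} \<inter> {\<alpha>. \<forall>i\<in>I. dnint (real (b * n) * \<alpha> $ i) \<le> (1 / 2) ^ l i / 2})
      \<le> (\<Prod>i\<in>I. (1 / 2) ^ (j i + l i) + min ((1 / 2) ^ j i / real a) ((1 / 2) ^ l i / real b))"
    if n: "0 < n" and ab: "0 < a" "0 < b" "coprime a b" for n j l a b and I :: "'n set"
  proof (induction I rule: infinite_finite_induct)
    case (insert i I)
    let ?F = "\<lambda>I. {\<alpha>. \<forall>i\<in>I. dnint (real (a * n) * \<alpha> $ i) \<le> (1 / 2) ^ j i / 2} \<inter> {\<alpha>. \<forall>i\<in>I. dnint (real (b * n) * \<alpha> $ i) \<le> (1 / 2) ^ l i / 2}"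
    let ?A = "{\<alpha>. dnint (real a * (real n * \<alpha> $ i)) \<le> (1 / 2) ^ j i / 2}"
      and ?B = "{\<alpha>. dnint (real b * (real n * \<alpha> $ i)) \<le> (1 / 2) ^ l i / 2}"
    let ?c = "\<lambda>i. (1 / 2) ^ (j i + l i) + min ((1 / 2) ^ j i / real a) ((1 / 2) ^ l i / real b)"
    have Fs: "?F I \<in> sets borel" "periodic (?F I)" by (intro sets.Int sets periodic_Int per)+
    have "(\<alpha> + \<tau> *\<^sub>R axis i (1 / real n)) $ i' = \<alpha> $ i'" if "i' \<in> I" for \<alpha> :: "real ^ 'n" and \<tau> i'
      using that insert by (intro coord) auto
    then have inv: "\<alpha> + \<tau> *\<^sub>R axis i (1 / real n) \<in> ?F I \<longleftrightarrow> \<alpha> \<in> ?F I" for \<alpha> \<tau>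
      by (auto simp only: mem_Collect_eq Int_iff)
    have ax: "real n * axis i (1 / real n) $ i = 1" using n by (simp add: axis_def)
    have 1: "prob (?F I \<inter> ?A \<inter> ?B) \<le> prob (?F I) * ((1 / 2) ^ j i * ((1 / 2) ^ l i + 1 / real a))"
      using measure_torus_dnint_le_pair[OF Fs inv integral_functional_coordinate ax half_power_bounds half_power_bounds(1) ab(1,3), of "j i" "l i"]
      by simp
    have ba: "coprime b a" using ab(3) by (simp add: coprime_commute)
    have 2: "prob (?F I \<inter> ?B \<inter> ?A) \<le> prob (?F I) * ((1 / 2) ^ l i * ((1 / 2) ^ j i + 1 / real b))"
      using measure_torus_dnint_le_pair[OF Fs inv integral_functional_coordinate ax half_power_bounds half_power_bounds(1) ab(2) ba, of "l i" "j i"]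
      by simp
    have "?F I \<inter> ?B \<inter> ?A = ?F I \<inter> ?A \<inter> ?B" by blast
    then have "prob (?F I \<inter> ?A \<inter> ?B) \<le> prob (?F I) * ?c i"
      unfolding power_add using 1 2 by (intro le_mult_add_min) (simp_all only:)
    also have "\<dots> \<le> (\<Prod>i\<in>I. ?c i) * ?c i" using insert by (intro mult_right_mono) auto
    also have "?F I \<inter> ?A \<inter> ?B = ?F (insert i I)" by (auto simp: mult.assoc)
    finally show ?case using insert by (simp add: mult.commute)
  qed (use prob_space in auto)
  have H: "?H q j = {\<alpha>. \<forall>i\<in>UNIV. dnint (real (q ()) * \<alpha> $ i) \<le> (1 / 2) ^ j i / 2}" for q j by (simp add: deep_iff)
  have pos: "0 < q ()" if "q \<noteq> (\<lambda>_. 0)" for q :: "unit \<Rightarrow> nat"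
    using that by (auto simp: fun_eq_iff)
  show ?thesis
  proof
    show "?x q i \<in> borel_measurable torus" for q i by measurable
    show "prob (?H q j) = (1 / 2) ^ sum j UNIV" if "q \<noteq> (\<lambda>_. 0)" for q j
      unfolding H by (simp only: single[OF pos[OF that]] power_sum)
    show "prob (?H (\<lambda>i. a * u i) j \<inter> ?H (\<lambda>i. b * u i) l)
        \<le> (\<Prod>i\<in>UNIV. (1 / 2) ^ (j i + l i) + min ((1 / 2) ^ j i / real a) ((1 / 2) ^ l i / real b))"
      if "u \<noteq> (\<lambda>_. 0)" "0 < a" "0 < b" "coprime a b" for u a b j l
      using pair[OF pos[OF that(1)] that(2-4), of UNIV j l] by (simp add: deep_iff)
    \<comment> \<open>Two nonzero vectors with a single entry are always parallel, so the premises
      are contradictory.\<close>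
    show "prob (?H q j \<inter> ?H q' l) \<le> (1 / 2) ^ sum j UNIV * (1 / 2) ^ sum l UNIV"
      if nz: "q \<noteq> (\<lambda>_. 0)" "q' \<noteq> (\<lambda>_. 0)" and
        np: "\<not> (\<exists>u a b. 0 < a \<and> 0 < b \<and> coprime a b \<and> q = (\<lambda>i. a * u i) \<and> q' = (\<lambda>i. b * u i))"
      for q q' j l
      using proportional_imp_multiples[OF nz] np by (simp add: mult.commute)
  qed
qed

subsection \<open>From boxes to arbitrary ranges\<close>

lemma logp_eq: "1 \<le> t \<Longrightarrow> logp t = max 1 (ln t)"
  unfolding logp_def by (cases "t \<le> exp 1") (auto simp: max_def ln_ge_iff ln_le_cancel_iff)

text \<open>The least k with t < 2 ^ 2 ^ k. The constant 4 combines a factor 2 for the step back to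
  k - 1 with the crude bound 1 / 2 \<le> ln 2; for k = 0 the cutoff in \<open>logp\<close> takes
  over.\<close>

lemma doubly_exponential_scale:
  assumes "1 \<le> (t::real)"
  obtains k :: nat where "t < 2 ^ 2 ^ k" "k = 0 \<or> 2 ^ 2 ^ (k - 1) \<le> t" "2 ^ k / 4 \<le> logp t" "logp t \<le> 2 ^ k"
proof -
  obtain N :: nat where N: "t < 2 ^ N" using real_arch_pow[of 2 t] by auto
  also have "(2::real) ^ N \<le> 2 ^ 2 ^ N" by (intro power_increasing) (simp_all add: less_imp_le)
  finally have ex: "\<exists>k::nat. t < 2 ^ 2 ^ k" by blast
  define k where "k = (LEAST k::nat. t < 2 ^ 2 ^ k)"
  have k: "t < 2 ^ 2 ^ k" unfolding k_def using ex by (rule LeastI_ex)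
  have kmin: "2 ^ 2 ^ (k - 1) \<le> t" if "k \<noteq> 0"
    using not_less_Least[of "k - 1" "\<lambda>k. t < 2 ^ 2 ^ k"] that unfolding k_def by auto
  have ln2: "1 / 2 \<le> ln (2::real)" "ln (2::real) \<le> 1"
    using ln2_ge_two_thirds ln_2_less_1 by linarith+
  note lp = logp_eq[OF assms]
  have "ln t \<le> ln (2 ^ 2 ^ k)" using k assms by (subst ln_le_cancel_iff) auto
  also have "\<dots> = 2 ^ k * ln 2" by (simp add: ln_realpow)
  also have "\<dots> \<le> 2 ^ k * 1" using ln2 by (intro mult_left_mono) auto
  finally have up: "logp t \<le> 2 ^ k" by (simp add: lp)
  have low: "2 ^ k / 4 \<le> logp t"
  proof (cases "k = 0")
    case False
    then have "(2::real) ^ k / 4 = 2 ^ (k - 1) * (1 / 2)" by (cases k) auto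
    also have "\<dots> \<le> 2 ^ (k - 1) * ln 2" using ln2 by (intro mult_left_mono) auto
    also have "\<dots> = ln (2 ^ 2 ^ (k - 1))" by (simp add: ln_realpow)
    also have "\<dots> \<le> ln t" using kmin[OF False] assms by (subst ln_le_cancel_iff) auto
    finally show ?thesis by (simp add: lp)
  qed (simp add: lp)
  show ?thesis using that[OF k _ low up] kmin by blast
qed

definition qset :: "('m::finite \<Rightarrow> real) \<Rightarrow> ('m \<Rightarrow> nat) set" where
  "qset T = {q. q \<noteq> (\<lambda>_. 0) \<and> (\<forall>i. real (q i) \<le> T i)}"

lemma weighted_sum_sandwich:
  fixes T :: "'m::finite \<Rightarrow> real" and f :: "('m \<Rightarrow> nat) \<Rightarrow> real"
  assumes f: "\<And>q. 0 \<le> f q" and T: "\<And>i. 1 \<le> T i" and c: "0 < c" "0 < C"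
    and bnd: "\<And>k. c * (real (bigL k) ^ r * bigP k) \<le> (\<Sum>q\<in>qbox k. f q) \<and> (\<Sum>q\<in>qbox k. f q) \<le> C * (real (bigL k) ^ r * bigP k)"
  defines "R \<equiv> (\<Sum>i\<in>UNIV. logp (T i)) ^ r * (\<Prod>i\<in>UNIV. logp (T i))"
  shows "c / 2 ^ (r + CARD('m)) * R \<le> (\<Sum>q\<in>qset T. f q)" "(\<Sum>q\<in>qset T. f q) \<le> C * 4 ^ (r + CARD('m)) * R"
proof -
  have "\<exists>k::nat. T i < 2 ^ 2 ^ k \<and> (k = 0 \<or> 2 ^ 2 ^ (k - 1) \<le> T i) \<and> 2 ^ k / 4 \<le> logp (T i) \<and> logp (T i) \<le> 2 ^ k" for i
    using doubly_exponential_scale[OF T[of i]] by metis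
  then obtain k :: "'m \<Rightarrow> nat" where k: "\<And>i. T i < 2 ^ 2 ^ k i" "\<And>i. k i = 0 \<or> 2 ^ 2 ^ (k i - 1) \<le> T i"
    "\<And>i. 2 ^ k i / 4 \<le> logp (T i)" "\<And>i. logp (T i) \<le> 2 ^ k i" by metis
  \<comment> \<open>Truncated subtraction is harmless: if k i = 0, the smaller box only asks for q i
    < 2, and T i is at least 1.\<close>
  define k' where "k' i = k i - 1" for i
  have logp0: "0 \<le> logp (T i)" for i using k(3)[of i] by (meson divide_nonneg_pos order_trans zero_le_numeral zero_le_power zero_less_numeral)
  have sub: "qset T \<subseteq> qbox k"
  proof
    fix q assume q: "q \<in> qset T"
    have "q i < 2 ^ 2 ^ k i" for i
    proof -
      have "real (q i) \<le> T i" using q by (simp add: qset_def)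
      from le_less_trans[OF this k(1)] have "real (q i) < real (2 ^ 2 ^ k i)"
        by (simp only: of_nat_power of_nat_numeral)
      then show ?thesis by (simp only: of_nat_less_iff)
    qed
    then show "q \<in> qbox k" using q by (auto simp: qset_def qbox_def)
  qed
  have sub': "qbox k' \<subseteq> qset T"
  proof
    fix q assume q: "q \<in> qbox k'"
    have "real (q i) \<le> T i" for i
    proof (cases "k i = 0")
      case True
      have "q i < 2 ^ 2 ^ k' i" using q by (simp add: qbox_def)
      then have "real (q i) \<le> 1" using True by (simp add: k'_def)
      then show ?thesis using T[of i] by linarith
    next
      case False
      have "q i < 2 ^ 2 ^ k' i" using q by (simp add: qbox_def)
      then have "real (q i) < real (2 ^ 2 ^ k' i)" by (simp only: of_nat_less_iff)
      moreover have "2 ^ 2 ^ (k i - 1) \<le> T i" using k(2)[of i] False by blast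
      then have "real (2 ^ 2 ^ k' i) \<le> T i" by (simp only: k'_def of_nat_power of_nat_numeral)
      ultimately show ?thesis by linarith
    qed
    then show "q \<in> qset T" using q by (auto simp: qset_def qbox_def)
  qed
  have fin: "finite (qset T)" using sub by (rule finite_subset) simp
  have "(2::real) ^ k i \<le> 2 * 2 ^ k' i" for i by (cases "k i") (simp_all add: k'_def)
  then have kk': "logp (T i) \<le> 2 * 2 ^ k' i" for i using k(4)[of i] by (meson order_trans)
  have L: "real (bigL l) = (\<Sum>i\<in>UNIV. 2 ^ l i)" for l :: "'m \<Rightarrow> nat" by (simp add: bigL_def)
  have P: "bigP l = (\<Prod>i\<in>UNIV. 2 ^ l i)" for l :: "'m \<Rightarrow> nat" by (simp add: bigP_def power_sum)
  have "R \<le> (\<Sum>i\<in>UNIV. 2 * 2 ^ k' i) ^ r * (\<Prod>i\<in>UNIV. 2 * 2 ^ k' i)"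
    unfolding R_def using kk' logp0 by (intro mult_mono power_mono sum_mono prod_mono) (auto intro!: prod_nonneg sum_nonneg zero_le_power)
  also have "\<dots> = 2 ^ (r + CARD('m)) * (real (bigL k') ^ r * bigP k')"
    by (simp add: L P sum_distrib_left[symmetric] prod.distrib power_mult_distrib power_add)
  finally have "c / 2 ^ (r + CARD('m)) * R \<le> c / 2 ^ (r + CARD('m)) * (2 ^ (r + CARD('m)) * (real (bigL k') ^ r * bigP k'))"
    using c by (intro mult_left_mono) auto
  also have "\<dots> = c * (real (bigL k') ^ r * bigP k')" by simp
  also have "\<dots> \<le> (\<Sum>q\<in>qbox k'. f q)" using bnd by blast
  also have "\<dots> \<le> (\<Sum>q\<in>qset T. f q)" using f by (intro sum_mono2 fin sub') auto
  finally show "c / 2 ^ (r + CARD('m)) * R \<le> (\<Sum>q\<in>qset T. f q)" .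
  have "real (bigL k) ^ r * bigP k \<le> (\<Sum>i\<in>UNIV. 4 * logp (T i)) ^ r * (\<Prod>i\<in>UNIV. 4 * logp (T i))"
    unfolding L P using k(3) logp0 by (intro mult_mono power_mono sum_mono prod_mono) (auto intro!: prod_nonneg sum_nonneg zero_le_power simp: field_simps)
  also have "\<dots> = 4 ^ (r + CARD('m)) * R"
    by (simp add: R_def sum_distrib_left[symmetric] prod.distrib power_mult_distrib power_add)
  finally have *: "C * (real (bigL k) ^ r * bigP k) \<le> C * (4 ^ (r + CARD('m)) * R)"
    using c by (intro mult_left_mono) auto
  have "(\<Sum>q\<in>qset T. f q) \<le> (\<Sum>q\<in>qbox k. f q)" using f by (intro sum_mono2 sub) auto
  also have "\<dots> \<le> C * (real (bigL k) ^ r * bigP k)" using bnd by blast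
  also note *
  finally show "(\<Sum>q\<in>qset T. f q) \<le> C * 4 ^ (r + CARD('m)) * R" by (simp only: mult.assoc)
qed

text \<open>The box estimates produce the sum of the logarithms, while the claim has the logarithm
  of the geometric mean. After cutting off at 1 they agree up to a factor that depends on the
  dimension only.\<close>

lemma logp_geometric_mean:
  fixes T :: "real ^ 'n"
  assumes T: "\<And>i. 1 \<le> T $ i"
  defines "G \<equiv> logp ((\<Prod>i\<in>UNIV. T $ i) powr (1 / real CARD('n)))"
  shows "G \<le> (\<Sum>i\<in>UNIV. logp (T $ i))" "(\<Sum>i\<in>UNIV. logp (T $ i)) \<le> 2 * real CARD('n) * G"
proof -
  let ?n = "real CARD('n)"
  have n: "1 \<le> ?n" by (simp add: Suc_leI)
  have Tp: "0 < T $ i" for i using T[of i] by linarith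
  have prod1: "1 \<le> (\<Prod>i\<in>UNIV. T $ i)" using T by (intro prod_ge_1) auto
  then have "1 \<le> (\<Prod>i\<in>UNIV. T $ i) powr (1 / ?n)" by (intro ge_one_powr_ge_zero) auto
  then have "G = max 1 (ln ((\<Prod>i\<in>UNIV. T $ i) powr (1 / ?n)))" unfolding G_def by (rule logp_eq)
  also have "ln ((\<Prod>i\<in>UNIV. T $ i) powr (1 / ?n)) = (\<Sum>i\<in>UNIV. ln (T $ i)) / ?n"
  proof -
    have "ln (\<Prod>i\<in>UNIV. T $ i) = (\<Sum>i\<in>UNIV. ln (T $ i))" by (rule ln_prod) (simp, metis Tp less_irrefl)
    then show ?thesis using prod1 by (subst ln_powr) auto
  qed
  finally have G: "G = max 1 ((\<Sum>i\<in>UNIV. ln (T $ i)) / ?n)" .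
  have ln0: "0 \<le> ln (T $ i)" for i using T[of i] by simp
  have s: "(\<Sum>i\<in>UNIV. logp (T $ i)) = (\<Sum>i\<in>UNIV. max 1 (ln (T $ i)))" by (simp add: logp_eq[OF T])
  show "G \<le> (\<Sum>i\<in>UNIV. logp (T $ i))"
  proof -
    have "?n = (\<Sum>i\<in>(UNIV::'n set). 1)" by simp
    also have "\<dots> \<le> (\<Sum>i\<in>UNIV. max 1 (ln (T $ i)))" by (intro sum_mono) auto
    finally have "1 \<le> (\<Sum>i\<in>UNIV. max 1 (ln (T $ i)))" using n by linarith
    moreover have "(\<Sum>i\<in>UNIV. ln (T $ i)) / ?n \<le> (\<Sum>i\<in>UNIV. ln (T $ i)) / 1"
      using ln0 n by (intro divide_left_mono sum_nonneg) auto
    moreover have "(\<Sum>i\<in>UNIV. ln (T $ i)) \<le> (\<Sum>i\<in>UNIV. max 1 (ln (T $ i)))" by (intro sum_mono) auto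
    ultimately show ?thesis unfolding G s by simp
  qed
  have "(\<Sum>i\<in>UNIV. max 1 (ln (T $ i))) \<le> (\<Sum>i\<in>UNIV. 1 + ln (T $ i))" using ln0 by (intro sum_mono) auto
  also have "\<dots> = ?n * 1 + ?n * ((\<Sum>i\<in>UNIV. ln (T $ i)) / ?n)" by (simp add: sum.distrib)
  also have "\<dots> \<le> ?n * G + ?n * G" unfolding G by (intro add_mono mult_left_mono) auto
  finally show "(\<Sum>i\<in>UNIV. logp (T $ i)) \<le> 2 * ?n * G" by (simp add: s mult_ac)
qed

lemma S_sum_eq:
  fixes \<alpha> T :: "real ^ 'n"
  shows "S_sum \<alpha> T = (\<Sum>q\<in>qset (\<lambda>i. T $ i). weight q * (\<Prod>i\<in>(UNIV::unit set). 1 / dnint (dot q \<alpha>)))"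
  unfolding S_sum_def
proof (rule sum.reindex_bij_witness[of _ "\<lambda>q. \<chi> i. int (q i)" "\<lambda>q i. nat (q $ i)"])
  fix q :: "int ^ 'n" assume q: "q \<in> {q. q \<noteq> 0 \<and> (\<forall>i. 0 \<le> q $ i \<and> real_of_int (q $ i) \<le> T $ i)}"
  then have q0: "\<And>i. 0 \<le> q $ i" by auto
  show "(\<chi> i. int (nat (q $ i))) = q" using q0 by (simp add: vec_eq_iff)
  obtain i where "q $ i \<noteq> 0" using q by (auto simp: vec_eq_iff)
  then have "nat (q $ i) \<noteq> 0" using q0[of i] by auto
  then have "(\<lambda>i. nat (q $ i)) \<noteq> (\<lambda>_. 0)" by (auto simp: fun_eq_iff)
  then show "(\<lambda>i. nat (q $ i)) \<in> qset (\<lambda>i. T $ i)" using q by (auto simp: qset_def)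
  have "real (nat (q $ i)) = real_of_int (q $ i)" for i using q0[of i] by simp
  then show "weight (\<lambda>i. nat (q $ i)) * (\<Prod>i\<in>(UNIV::unit set). 1 / dnint (dot (\<lambda>i. nat (q $ i)) \<alpha>))
      = 1 / ((\<Prod>i\<in>UNIV. posp (real_of_int (q $ i))) * dnint (\<Sum>i\<in>UNIV. real_of_int (q $ i) * \<alpha> $ i))"
    by (simp add: weight_def dot_def posp_def UNIV_unit prod_dividef)
next
  fix q assume q: "q \<in> qset (\<lambda>i. T $ i)"
  show "(\<lambda>i. nat ((\<chi> i. int (q i)) $ i)) = q" by simp
  show "(\<chi> i. int (q i)) \<in> {q. q \<noteq> 0 \<and> (\<forall>i. 0 \<le> q $ i \<and> real_of_int (q $ i) \<le> T $ i)}"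
    using q by (auto simp: qset_def vec_eq_iff fun_eq_iff)
qed

lemma S_star_eq:
  fixes \<alpha> :: "real ^ 'n"
  shows "S_star \<alpha> T = (\<Sum>q\<in>qset (\<lambda>_::unit. T). weight q * (\<Prod>i\<in>UNIV. 1 / dnint (real (q ()) * \<alpha> $ i)))"
  unfolding S_star_def
  by (rule sum.reindex_bij_witness[of _ "\<lambda>q. q ()" "\<lambda>q _. q"])
    (auto simp: qset_def fun_eq_iff weight_def UNIV_unit prod_dividef max_def)

theorem mainTheorem2:
  shows "(AE \<alpha> in (lborel :: (real ^ 'n) measure).
            \<exists>c>0. \<exists>C>0. \<forall>T :: real ^ 'n. (\<forall>i. 1 \<le> T $ i) \<longrightarrow>
              (let R = logp ((\<Prod>i\<in>UNIV. T $ i) powr (1 / real CARD('n)))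
                       * (\<Prod>i\<in>UNIV. logp (T $ i))
               in c * R \<le> S_sum \<alpha> T \<and> S_sum \<alpha> T \<le> C * R))
       \<and> (AE \<alpha> in (lborel :: (real ^ 'n) measure).
            \<exists>c>0. \<exists>C>0. \<forall>T :: real. 1 \<le> T \<longrightarrow>
              c * logp T ^ (CARD('n) + 1) \<le> S_star \<alpha> T \<and>
              S_star \<alpha> T \<le> C * logp T ^ (CARD('n) + 1))"
proof
  let ?n = "real CARD('n)"
  let ?f = "\<lambda>\<alpha> (q :: 'n \<Rightarrow> nat). weight q * (\<Prod>i\<in>(UNIV::unit set). 1 / dnint (dot q \<alpha>))"
  let ?P = "\<lambda>\<alpha>. \<exists>c>0. \<exists>C>0. \<forall>k :: 'n \<Rightarrow> nat. c * (real (bigL k) ^ CARD(unit) * bigP k) \<le> (\<Sum>q\<in>qbox k. ?f \<alpha> q)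
      \<and> (\<Sum>q\<in>qbox k. ?f \<alpha> q) \<le> C * (real (bigL k) ^ CARD(unit) * bigP k)"
  have "AE \<alpha> in torus. ?P \<alpha>"
    by (rule lattice_phases.AE_weighted_sum_asymp[OF lattice_phases_dot])
  \<comment> \<open>The two-sided bounds depend on \<alpha> only through these distances. They are
    therefore lattice periodic and pass from the torus to Lebesgue measure.\<close>
  moreover have "dnint (dot q (\<alpha> + lattice_vec m)) = dnint (dot q \<alpha>)" for q :: "'n \<Rightarrow> nat" and \<alpha> m
    using integral_functional_dot[of q] by (simp add: dot_add dnint_add_Ints integral_functional_def)
  then have "?P (\<alpha> + lattice_vec m) \<longleftrightarrow> ?P \<alpha>" for \<alpha> m by (simp only:)
  ultimately have "AE \<alpha> in lborel. ?P \<alpha>" by (intro AE_lborel_if_AE_torus)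
  then show "AE \<alpha> in (lborel :: (real ^ 'n) measure).
            \<exists>c>0. \<exists>C>0. \<forall>T :: real ^ 'n. (\<forall>i. 1 \<le> T $ i) \<longrightarrow>
              (let R = logp ((\<Prod>i\<in>UNIV. T $ i) powr (1 / real CARD('n)))
                       * (\<Prod>i\<in>UNIV. logp (T $ i))
               in c * R \<le> S_sum \<alpha> T \<and> S_sum \<alpha> T \<le> C * R)"
  proof eventually_elim
    case (elim \<alpha>)
    then obtain c C where c: "0 < c" "0 < C" and bnd: "\<And>k :: 'n \<Rightarrow> nat. c * (real (bigL k) ^ CARD(unit) * bigP k) \<le> (\<Sum>q\<in>qbox k. ?f \<alpha> q)
      \<and> (\<Sum>q\<in>qbox k. ?f \<alpha> q) \<le> C * (real (bigL k) ^ CARD(unit) * bigP k)" by blast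
    have f0: "0 \<le> ?f \<alpha> q" for q by (intro mult_nonneg_nonneg prod_nonneg) auto
    let ?c = "c / 2 ^ (CARD(unit) + CARD('n))" and ?C = "C * 4 ^ (CARD(unit) + CARD('n)) * (2 * ?n)"
    show ?case
    proof (rule exI[of _ ?c], rule conjI[OF _ exI[of _ ?C]], use c in simp, intro conjI allI impI)
      show "0 < ?C" using c by simp
      fix T :: "real ^ 'n" assume "\<forall>i. 1 \<le> T $ i"
      then have T: "\<And>i. 1 \<le> T $ i" by blast
      define G where "G = logp ((\<Prod>i\<in>UNIV. T $ i) powr (1 / ?n))"
      define L where "L = (\<Sum>i\<in>UNIV. logp (T $ i))"
      define P where "P = (\<Prod>i\<in>UNIV. logp (T $ i))"
      have GL: "G \<le> L" "L \<le> 2 * ?n * G" unfolding G_def L_def by (rule logp_geometric_mean[OF T])+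
      have P0: "0 \<le> P" unfolding P_def by (intro prod_nonneg) (simp add: logp_eq[OF T])
      have sw: "?c * (L ^ CARD(unit) * P) \<le> S_sum \<alpha> T"
        "S_sum \<alpha> T \<le> C * 4 ^ (CARD(unit) + CARD('n)) * (L ^ CARD(unit) * P)"
        unfolding L_def P_def S_sum_eq by (rule weighted_sum_sandwich[OF f0 T c bnd])+
      have "?c * (G * P) \<le> ?c * (L ^ CARD(unit) * P)"
        using c GL P0 by (intro mult_left_mono mult_right_mono) auto
      also have "\<dots> \<le> S_sum \<alpha> T" by (rule sw(1))
      finally have 1: "?c * (G * P) \<le> S_sum \<alpha> T" .
      have "S_sum \<alpha> T \<le> C * 4 ^ (CARD(unit) + CARD('n)) * (L ^ CARD(unit) * P)" by (rule sw(2))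
      also have "\<dots> \<le> C * 4 ^ (CARD(unit) + CARD('n)) * ((2 * ?n * G) * P)"
        using c GL P0 by (intro mult_left_mono mult_right_mono) auto
      also have "\<dots> = ?C * (G * P)" by (simp only: mult.assoc)
      finally show "let R = logp ((\<Prod>i\<in>UNIV. T $ i) powr (1 / ?n)) * (\<Prod>i\<in>UNIV. logp (T $ i))
          in ?c * R \<le> S_sum \<alpha> T \<and> S_sum \<alpha> T \<le> ?C * R"
        using 1 unfolding Let_def G_def P_def by blast
    qed
  qed
next
  let ?f = "\<lambda>(\<alpha> :: real ^ 'n) (q :: unit \<Rightarrow> nat). weight q * (\<Prod>i\<in>UNIV. 1 / dnint (real (q ()) * \<alpha> $ i))"
  let ?P = "\<lambda>\<alpha>. \<exists>c>0. \<exists>C>0. \<forall>k :: unit \<Rightarrow> nat. c * (real (bigL k) ^ CARD('n) * bigP k) \<le> (\<Sum>q\<in>qbox k. ?f \<alpha> q)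
      \<and> (\<Sum>q\<in>qbox k. ?f \<alpha> q) \<le> C * (real (bigL k) ^ CARD('n) * bigP k)"
  have "AE \<alpha> in torus. ?P \<alpha>"
    by (rule lattice_phases.AE_weighted_sum_asymp[OF lattice_phases_coordinates])
  moreover have "dnint (real n * (\<alpha> + lattice_vec m) $ i) = dnint (real n * \<alpha> $ i)" for n i m and \<alpha> :: "real ^ 'n"
    unfolding vector_add_component distrib_left by (rule dnint_add_Ints) (auto simp: lattice_vec_def intro!: Ints_mult)
  then have "?P (\<alpha> + lattice_vec m) \<longleftrightarrow> ?P \<alpha>" for \<alpha> m by (simp only:)
  ultimately have "AE \<alpha> in lborel. ?P \<alpha>" by (intro AE_lborel_if_AE_torus)
  then show "AE \<alpha> in (lborel :: (real ^ 'n) measure).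
            \<exists>c>0. \<exists>C>0. \<forall>T :: real. 1 \<le> T \<longrightarrow>
              c * logp T ^ (CARD('n) + 1) \<le> S_star \<alpha> T \<and>
              S_star \<alpha> T \<le> C * logp T ^ (CARD('n) + 1)"
  proof eventually_elim
    case (elim \<alpha>)
    then obtain c C where c: "0 < c" "0 < C" and bnd: "\<And>k :: unit \<Rightarrow> nat. c * (real (bigL k) ^ CARD('n) * bigP k) \<le> (\<Sum>q\<in>qbox k. ?f \<alpha> q)
      \<and> (\<Sum>q\<in>qbox k. ?f \<alpha> q) \<le> C * (real (bigL k) ^ CARD('n) * bigP k)" by blast
    have f0: "0 \<le> ?f \<alpha> q" for q by (intro mult_nonneg_nonneg prod_nonneg) auto
    let ?c = "c / 2 ^ (CARD('n) + CARD(unit))" and ?C = "C * 4 ^ (CARD('n) + CARD(unit))"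
    show ?case
    proof (rule exI[of _ ?c], rule conjI[OF _ exI[of _ ?C]], use c in simp, intro conjI allI impI)
      show "0 < ?C" using c by simp
      fix T :: real assume T: "1 \<le> T"
      have R: "(\<Sum>i\<in>(UNIV::unit set). logp T) ^ CARD('n) * (\<Prod>i\<in>(UNIV::unit set). logp T) = logp T ^ (CARD('n) + 1)"
        by (simp add: UNIV_unit mult.commute)
      note sw = weighted_sum_sandwich[OF f0 T c bnd, unfolded R, folded S_star_eq]
      show "?c * logp T ^ (CARD('n) + 1) \<le> S_star \<alpha> T" by (rule sw(1))
      show "S_star \<alpha> T \<le> ?C * logp T ^ (CARD('n) + 1)" by (rule sw(2))
    qed
  qed
qed

end
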